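(* Let $X$ be a Riemann surface, let $(M,\mathbf P,g)$ be a para-Kähler manifold of dimension $2n$ with constant para-holomorphic sectional curvature, and let $\varphi:X\to M$ be a harmonic map with (finite) isotropic order $\gamma$. Then (i) for all integers $\alpha,\beta\ge1$ with $\alpha+\beta=\gamma+1$, we have $\eta_{\alpha,\beta}=(-1)^{\beta-1}\eta_{\gamma,1}$; (ii) the tensor $\eta_{\gamma,1}\,dz^{\gamma+1}$ is holomorphic.
   Context: A para-Kähler manifold $(M,\mathbf P,g)$: $\mathbf P\in\mathrm{End}(TM)$ with $\mathbf P^2=\mathrm{Id}$ and $\pm1$-eigendistributions of equal rank and involutive, $g$ pseudo-Riemannian with $g(\mathbf P\cdot,\mathbf P\cdot)=-g$, and $g(\cdot,\mathbf P\cdot)$ closed (so $\mathbf P$ is parallel). The para-holomorphic sectional curvature is the sectional curvature of the planes spanned by $V,\mathbf PV$ with $V$ non-isotropic. $\mathbb R_\tau=\{x+\tau y\}$ with $\tau^2=1$; set $\mathbf q(V,W)=g(V,W)+\tau g(V,\mathbf PW)$. Extend $\mathbf q$ to $\mathbf q^{\mathbb C}$ on $TM\otimes\mathbb C$ (with values in $\mathbb R_\tau\otimes_{\mathbb R}\mathbb C$), $\mathbb C$-linear in the first entry and $\mathbb C$-antilinear in the second. $\overline\nabla$ is the $\mathbb C$-linear extension to $\varphi^*(TM\otimes\mathbb C)$ of the pull-back of the Levi-Civita connection of $g$. For a local complex coordinate $z$ on $X$: $\varphi_{z,1}=d_{\mathbb C}\varphi(\partial_z)$, $\varphi_{\bar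 z,1}=d_{\mathbb C}\varphi(\partial_{\bar z})$, $\varphi_{z,k}=\overline\nabla_{\partial_z}\varphi_{z,k-1}$, $\varphi_{\bar z,k}=\overline\nabla_{\partial_{\bar z}}\varphi_{\bar z,k-1}$ for $k\ge2$. Set $\eta_{\alpha,\beta}=\mathbf q^{\mathbb C}(\varphi_{z,\alpha},\varphi_{\bar z,\beta})$ for $\alpha,\beta\ge1$. The isotropic order of $\varphi$ is the largest $\gamma\in\mathbb N_{\ge1}\cup\{\infty\}$ such that in all local charts $\eta_{\alpha,\beta}=0$ for all $\alpha,\beta\ge1$ with $\alpha+\beta\le\gamma$. $\varphi$ is harmonic iff $\overline\nabla_{\partial_{\bar z}}\varphi_{z,1}=0$. Holomorphic means $\partial_{\bar z}\eta_{\gamma,1}=0$ in every chart. *)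

theory Defs
  imports "HOL-Analysis.Analysis"
begin

text \<open>
  Manifolds are Hausdorff spaces with a maximal atlas; tensor fields are families of
  component functions, one for each chart, obeying the transformation law.
\<close>

section \<open>Smooth maps\<close>

primrec k_smooth_on ::
  "nat \<Rightarrow> 'a::real_normed_vector set \<Rightarrow> ('a \<Rightarrow> 'b::real_normed_vector) \<Rightarrow> bool" where
  "k_smooth_on 0 S f \<longleftrightarrow> continuous_on S f"
| "k_smooth_on (Suc k) S f \<longleftrightarrow> (\<forall>x\<in>S. f differentiable (at x)) \<and>
     (\<forall>v. k_smooth_on k S (\<lambda>x. frechet_derivative f (at x) v))"

text \<open>Only used for open sets \<open>S\<close>.\<close>

definition smooth_on ::
  "'a::real_normed_vector set \<Rightarrow> ('a \<Rightarrow> 'b::real_normed_vector) \<Rightarrow> bool" where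
  "smooth_on S f \<longleftrightarrow> (\<forall>k. k_smooth_on k S f)"

section \<open>Charts and manifolds\<close>

text \<open>A chart \<open>(U, u)\<close> is an open set with a homeomorphism onto an open set of the model
  space; values of \<open>u\<close> outside \<open>U\<close> are irrelevant.\<close>

type_synonym ('p, 'v) chart = "'p set \<times> ('p \<Rightarrow> 'v)"

abbreviation chart_inv :: "('p, 'v) chart \<Rightarrow> 'v \<Rightarrow> 'p" where
  "chart_inv c \<equiv> inv_into (fst c) (snd c)"

abbreviation chart_img :: "('p, 'v) chart \<Rightarrow> 'v set" where
  "chart_img c \<equiv> snd c ` fst c"

definition is_chart :: "('p::topological_space, 'v::topological_space) chart \<Rightarrow> bool" where
  "is_chart c \<longleftrightarrow> open (fst c) \<and> open (chart_img c) \<and>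
     homeomorphism (fst c) (chart_img c) (snd c) (chart_inv c)"

definition transition :: "('p, 'v) chart \<Rightarrow> ('p, 'v) chart \<Rightarrow> 'v \<Rightarrow> 'v" where
  "transition c c' = snd c' \<circ> chart_inv c"

definition compatible ::
  "('v set \<Rightarrow> ('v \<Rightarrow> 'v) \<Rightarrow> bool) \<Rightarrow> ('p, 'v) chart \<Rightarrow> ('p, 'v) chart \<Rightarrow> bool" where
  "compatible reg c c' \<longleftrightarrow>
     reg (snd c ` (fst c \<inter> fst c')) (transition c c') \<and>
     reg (snd c' ` (fst c \<inter> fst c')) (transition c' c)"

definition maximal_atlas ::
  "('v set \<Rightarrow> ('v \<Rightarrow> 'v) \<Rightarrow> bool) \<Rightarrow>
   ('p::topological_space, 'v::topological_space) chart set \<Rightarrow> bool" where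
  "maximal_atlas reg \<A> \<longleftrightarrow>
     (\<forall>c\<in>\<A>. is_chart c) \<and> (\<Union>c\<in>\<A>. fst c) = UNIV \<and>
     (\<forall>c\<in>\<A>. \<forall>c'\<in>\<A>. compatible reg c c') \<and>
     (\<forall>c. is_chart c \<and> (\<forall>c'\<in>\<A>. compatible reg c c') \<longrightarrow> c \<in> \<A>)"

definition smooth_manifold ::
  "('p::{t2_space, second_countable_topology}, real ^ 'm) chart set \<Rightarrow> bool" where
  "smooth_manifold \<A> \<longleftrightarrow> maximal_atlas smooth_on \<A>"

definition riemann_surface :: "('x::t2_space, complex) chart set \<Rightarrow> bool" where
  "riemann_surface \<X> \<longleftrightarrow> maximal_atlas (\<lambda>S f. f holomorphic_on S) \<X>"

section \<open>Para-Kaehler manifolds\<close>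

text \<open>Components of a rank two tensor field: \<open>T c x\<close> is the component matrix with respect to
  the chart \<open>c\<close> at the point with coordinates \<open>x\<close>. For the metric,
  \<open>g c x $ i $ j\<close> is \<open>g(\<partial>\<^sub>i, \<partial>\<^sub>j)\<close>; for an endomorphism \<open>P c x *v v\<close> is the image of the
  tangent vector with components \<open>v\<close>.\<close>

type_synonym ('p, 'm) tensor2 = "('p, real ^ 'm) chart \<Rightarrow> real ^ 'm \<Rightarrow> real ^ 'm ^ 'm"

definition jacobian :: "('p, real ^ 'm) chart \<Rightarrow> ('p, real ^ 'm) chart \<Rightarrow> real ^ 'm \<Rightarrow> real ^ 'm ^ 'm" where
  "jacobian c c' x = matrix (frechet_derivative (transition c c') (at x))"

definition bilinear_tensor :: "('p, real ^ 'm) chart set \<Rightarrow> ('p, 'm) tensor2 \<Rightarrow> bool" where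
  "bilinear_tensor \<A> g \<longleftrightarrow> (\<forall>c\<in>\<A>. smooth_on (chart_img c) (g c)) \<and>
     (\<forall>c\<in>\<A>. \<forall>c'\<in>\<A>. \<forall>x \<in> snd c ` (fst c \<inter> fst c').
        g c x = transpose (jacobian c c' x) ** g c' (transition c c' x) ** jacobian c c' x)"

definition endomorphism_tensor :: "('p, real ^ 'm) chart set \<Rightarrow> ('p, 'm) tensor2 \<Rightarrow> bool" where
  "endomorphism_tensor \<A> P \<longleftrightarrow> (\<forall>c\<in>\<A>. smooth_on (chart_img c) (P c)) \<and>
     (\<forall>c\<in>\<A>. \<forall>c'\<in>\<A>. \<forall>x \<in> snd c ` (fst c \<inter> fst c').
        jacobian c c' x ** P c x = P c' (transition c c' x) ** jacobian c c' x)"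

definition bform :: "real ^ 'm ^ 'm \<Rightarrow> real ^ 'm \<Rightarrow> real ^ 'm \<Rightarrow> real" where
  "bform G v w = (\<Sum>i\<in>UNIV. \<Sum>j\<in>UNIV. G $ i $ j * v $ i * w $ j)"

definition pseudo_riemannian :: "('p, real ^ 'm) chart set \<Rightarrow> ('p, 'm) tensor2 \<Rightarrow> bool" where
  "pseudo_riemannian \<A> g \<longleftrightarrow> bilinear_tensor \<A> g \<and>
     (\<forall>c\<in>\<A>. \<forall>x\<in>chart_img c. (\<forall>v w. bform (g c x) v w = bform (g c x) w v) \<and>
        (\<forall>v. (\<forall>w. bform (g c x) v w = 0) \<longrightarrow> v = 0))"

definition pderiv_at :: "'m \<Rightarrow> (real ^ 'm \<Rightarrow> real) \<Rightarrow> real ^ 'm \<Rightarrow> real" where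
  "pderiv_at i f x = frechet_derivative f (at x) (axis i 1)"

definition lie_bracket ::
  "(real ^ 'm \<Rightarrow> real ^ 'm) \<Rightarrow> (real ^ 'm \<Rightarrow> real ^ 'm) \<Rightarrow> real ^ 'm \<Rightarrow> real ^ 'm" where
  "lie_bracket X Y x = frechet_derivative Y (at x) (X x) - frechet_derivative X (at x) (Y x)"

text \<open>Involutivity of the distribution \<open>ker (P - s)\<close>: it is closed under brackets of its
  smooth local sections.\<close>

definition involutive_eigendistribution ::
  "('p, real ^ 'm) chart set \<Rightarrow> ('p, 'm) tensor2 \<Rightarrow> real \<Rightarrow> bool" where
  "involutive_eigendistribution \<A> P s \<longleftrightarrow>
     (\<forall>c\<in>\<A>. \<forall>V X Y. open V \<and> V \<subseteq> chart_img c \<and> smooth_on V X \<and> smooth_on V Y \<and>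
        (\<forall>x\<in>V. P c x *v X x = s *\<^sub>R X x) \<and> (\<forall>x\<in>V. P c x *v Y x = s *\<^sub>R Y x) \<longrightarrow>
        (\<forall>x\<in>V. P c x *v lie_bracket X Y x = s *\<^sub>R lie_bracket X Y x))"

definition fundamental_form ::
  "('p, 'm::finite) tensor2 \<Rightarrow> ('p, 'm) tensor2 \<Rightarrow> ('p, 'm) tensor2" where
  "fundamental_form P g c x = (\<chi> i j. bform (g c x) (axis i 1) (P c x *v axis j 1))"

definition closed_two_form :: "('p, real ^ 'm) chart set \<Rightarrow> ('p, 'm) tensor2 \<Rightarrow> bool" where
  "closed_two_form \<A> \<omega> \<longleftrightarrow> (\<forall>c\<in>\<A>. \<forall>x\<in>chart_img c. \<forall>i j k.
     pderiv_at i (\<lambda>y. \<omega> c y $ j $ k) x + pderiv_at j (\<lambda>y. \<omega> c y $ k $ i) x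
       + pderiv_at k (\<lambda>y. \<omega> c y $ i $ j) x = 0)"

definition para_kaehler ::
  "('p::{t2_space, second_countable_topology}, real ^ 'm) chart set \<Rightarrow>
   ('p, 'm) tensor2 \<Rightarrow> ('p, 'm) tensor2 \<Rightarrow> bool" where
  "para_kaehler \<A> P g \<longleftrightarrow>
     smooth_manifold \<A> \<and> endomorphism_tensor \<A> P \<and> pseudo_riemannian \<A> g \<and>
     (\<forall>c\<in>\<A>. \<forall>x\<in>chart_img c.
        P c x ** P c x = mat 1 \<and>
        dim {v. P c x *v v = v} = dim {v. P c x *v v = - v} \<and>
        (\<forall>v w. bform (g c x) (P c x *v v) (P c x *v w) = - bform (g c x) v w)) \<and>
     involutive_eigendistribution \<A> P 1 \<and> involutive_eigendistribution \<A> P (-1) \<and>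
     closed_two_form \<A> (fundamental_form P g)"

section \<open>Levi-Civita connection and curvature\<close>

text \<open>\<open>christoffel G k i j\<close> is the Christoffel symbol with upper index \<open>k\<close> and lower indices
  \<open>i\<close>, \<open>j\<close> of the metric with component functions \<open>G\<close>.\<close>

definition christoffel ::
  "(real ^ 'm \<Rightarrow> real ^ 'm ^ 'm) \<Rightarrow> 'm \<Rightarrow> 'm \<Rightarrow> 'm \<Rightarrow> real ^ 'm \<Rightarrow> real" where
  "christoffel G k i j x = 1/2 * (\<Sum>l\<in>UNIV. matrix_inv (G x) $ k $ l *
     (pderiv_at i (\<lambda>y. G y $ j $ l) x + pderiv_at j (\<lambda>y. G y $ i $ l) x
       - pderiv_at l (\<lambda>y. G y $ i $ j) x))"

text \<open>The curvature tensor with the convention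
  \<open>R(X,Y)Z = \<nabla>\<^sub>X \<nabla>\<^sub>Y Z - \<nabla>\<^sub>Y \<nabla>\<^sub>X Z - \<nabla>\<^bsub>[X,Y]\<^esub> Z\<close>, evaluated on \<open>u\<close>, \<open>v\<close>, \<open>w\<close>.\<close>

definition curvature ::
  "(real ^ 'm \<Rightarrow> real ^ 'm ^ 'm) \<Rightarrow> real ^ 'm \<Rightarrow> real ^ 'm \<Rightarrow> real ^ 'm \<Rightarrow> real ^ 'm \<Rightarrow> real ^ 'm" where
  "curvature G x u v w = (\<chi> l. \<Sum>i\<in>UNIV. \<Sum>j\<in>UNIV. \<Sum>k\<in>UNIV. u $ i * v $ j * w $ k *
     (pderiv_at i (christoffel G l j k) x - pderiv_at j (christoffel G l i k) x
      + (\<Sum>m\<in>UNIV. christoffel G l i m x * christoffel G m j k x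
                  - christoffel G l j m x * christoffel G m i k x)))"

definition sectional_curvature ::
  "(real ^ 'm \<Rightarrow> real ^ 'm ^ 'm) \<Rightarrow> real ^ 'm \<Rightarrow> real ^ 'm \<Rightarrow> real ^ 'm \<Rightarrow> real" where
  "sectional_curvature G x u v =
     bform (G x) (curvature G x u v v) u /
     (bform (G x) u u * bform (G x) v v - (bform (G x) u v)\<^sup>2)"

definition constant_para_holomorphic_curvature ::
  "('p, real ^ 'm) chart set \<Rightarrow> ('p, 'm) tensor2 \<Rightarrow> ('p, 'm) tensor2 \<Rightarrow> bool" where
  "constant_para_holomorphic_curvature \<A> P g \<longleftrightarrow>
     (\<exists>\<kappa>. \<forall>c\<in>\<A>. \<forall>x\<in>chart_img c. \<forall>v. bform (g c x) v v \<noteq> 0 \<longrightarrow>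
        sectional_curvature (g c) x v (P c x *v v) = \<kappa>)"

section \<open>Maps from a Riemann surface\<close>

definition d_z :: "(complex \<Rightarrow> complex) \<Rightarrow> complex \<Rightarrow> complex" where
  "d_z f \<zeta> = (frechet_derivative f (at \<zeta>) 1 - \<i> * frechet_derivative f (at \<zeta>) \<i>) / 2"

definition d_zbar :: "(complex \<Rightarrow> complex) \<Rightarrow> complex \<Rightarrow> complex" where
  "d_zbar f \<zeta> = (frechet_derivative f (at \<zeta>) 1 + \<i> * frechet_derivative f (at \<zeta>) \<i>) / 2"

text \<open>Local expression of \<open>\<phi>\<close> in a chart \<open>z\<close> of the surface and a chart \<open>c\<close> of the target,
  and its domain (in terms of the coordinate \<open>z\<close>).\<close>

definition local_rep ::
  "('x \<Rightarrow> 'p) \<Rightarrow> ('x, complex) chart \<Rightarrow> ('p, 'v) chart \<Rightarrow> complex \<Rightarrow> 'v" where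
  "local_rep \<phi> z c = snd c \<circ> \<phi> \<circ> chart_inv z"

definition local_dom ::
  "('x \<Rightarrow> 'p) \<Rightarrow> ('x, complex) chart \<Rightarrow> ('p, 'v) chart \<Rightarrow> complex set" where
  "local_dom \<phi> z c = snd z ` (fst z \<inter> \<phi> -` fst c)"

definition smooth_map ::
  "('x::topological_space, complex) chart set \<Rightarrow> ('p::topological_space, real ^ 'm) chart set \<Rightarrow>
   ('x \<Rightarrow> 'p) \<Rightarrow> bool" where
  "smooth_map \<X> \<A> \<phi> \<longleftrightarrow> continuous_on UNIV \<phi> \<and>
     (\<forall>z\<in>\<X>. \<forall>c\<in>\<A>. smooth_on (local_dom \<phi> z c) (local_rep \<phi> z c))"

text \<open>Sections of the pull-back of the complexified tangent bundle are given by their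
  components with respect to the coordinate frame of a target chart. In the following,
  \<open>D\<close> is one of the operators \<open>d_z\<close>, \<open>d_zbar\<close>, \<open>f\<close> is the local expression of the map and
  \<open>G\<close> are the components of the metric.\<close>

definition velocity ::
  "((complex \<Rightarrow> complex) \<Rightarrow> complex \<Rightarrow> complex) \<Rightarrow> (complex \<Rightarrow> real ^ 'm) \<Rightarrow> complex \<Rightarrow> complex ^ 'm" where
  "velocity D f \<zeta> = (\<chi> k. D (\<lambda>w. complex_of_real (f w $ k)) \<zeta>)"

definition pullback_nabla ::
  "((complex \<Rightarrow> complex) \<Rightarrow> complex \<Rightarrow> complex) \<Rightarrow> (real ^ 'm \<Rightarrow> real ^ 'm ^ 'm) \<Rightarrow>
   (complex \<Rightarrow> real ^ 'm) \<Rightarrow> (complex \<Rightarrow> complex ^ 'm) \<Rightarrow> complex \<Rightarrow> complex ^ 'm" where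
  "pullback_nabla D G f s \<zeta> = (\<chi> k. D (\<lambda>w. s w $ k) \<zeta> +
     (\<Sum>i\<in>UNIV. \<Sum>j\<in>UNIV.
        complex_of_real (christoffel G k i j (f \<zeta>)) * velocity D f \<zeta> $ i * s \<zeta> $ j))"

text \<open>The iterated derivative \<open>\<phi>\<^bsub>z,k\<^esub>\<close> (for \<open>D = d_z\<close>) or \<open>\<phi>\<^bsub>zbar,k\<^esub>\<close> (for \<open>D = d_zbar\<close>);
  meaningful for \<open>k \<ge> 1\<close>.\<close>

definition iterated_derivative ::
  "((complex \<Rightarrow> complex) \<Rightarrow> complex \<Rightarrow> complex) \<Rightarrow> (real ^ 'm \<Rightarrow> real ^ 'm ^ 'm) \<Rightarrow>
   (complex \<Rightarrow> real ^ 'm) \<Rightarrow> nat \<Rightarrow> complex \<Rightarrow> complex ^ 'm" where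
  "iterated_derivative D G f k = (pullback_nabla D G f ^^ (k - 1)) (velocity D f)"

definition harmonic_map ::
  "('x::topological_space, complex) chart set \<Rightarrow> ('p::topological_space, real ^ 'm) chart set \<Rightarrow>
   ('p, 'm) tensor2 \<Rightarrow> ('x \<Rightarrow> 'p) \<Rightarrow> bool" where
  "harmonic_map \<X> \<A> g \<phi> \<longleftrightarrow> smooth_map \<X> \<A> \<phi> \<and>
     (\<forall>z\<in>\<X>. \<forall>c\<in>\<A>. \<forall>\<zeta>\<in>local_dom \<phi> z c.
        pullback_nabla d_zbar (g c) (local_rep \<phi> z c)
          (iterated_derivative d_z (g c) (local_rep \<phi> z c) 1) \<zeta> = 0)"

section \<open>The sesquilinear form and the isotropic order\<close>

text \<open>The pair \<open>(a, b)\<close> stands for \<open>a + \<tau> b\<close>: the complexification of the para-complex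
  numbers \<open>x + \<tau> y\<close> is the free complex vector space on \<open>1\<close> and \<open>\<tau>\<close>, and only its vector space
  structure enters below.\<close>

type_synonym para_complexified = "complex \<times> complex"

text \<open>The sesquilinear extension of \<open>q(V,W) = g(V,W) + \<tau> g(V,P W)\<close>, with \<open>G\<close> and \<open>J\<close> the
  matrices of \<open>g\<close> and \<open>P\<close> at a point: linear in \<open>V\<close>, antilinear in \<open>W\<close>. Its value on the
  coordinate frame is \<open>q(\<partial>\<^sub>i, \<partial>\<^sub>j)\<close>.\<close>

definition q_frame :: "real ^ 'm ^ 'm \<Rightarrow> real ^ 'm ^ 'm \<Rightarrow> 'm \<Rightarrow> 'm \<Rightarrow> real \<times> real" where
  "q_frame G J i j =
     (bform G (axis i 1) (axis j 1), bform G (axis i 1) (J *v axis j 1))"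

definition q_complex ::
  "real ^ 'm ^ 'm \<Rightarrow> real ^ 'm ^ 'm \<Rightarrow> complex ^ 'm \<Rightarrow> complex ^ 'm \<Rightarrow> para_complexified" where
  "q_complex G J V W = (\<Sum>i\<in>UNIV. \<Sum>j\<in>UNIV.
     (complex_of_real (fst (q_frame G J i j)) * V $ i * cnj (W $ j),
      complex_of_real (snd (q_frame G J i j)) * V $ i * cnj (W $ j)))"

text \<open>\<open>eta P g \<phi> z c \<alpha> \<beta>\<close> is \<open>\<eta>\<^bsub>\<alpha>,\<beta>\<^esub>\<close> as a function of the coordinate \<open>z\<close>, computed in the target
  chart \<open>c\<close> on \<open>local_dom \<phi> z c\<close>. Its value does not depend on the choice of \<open>c\<close>, all
  ingredients being tensorial in the target.\<close>

definition eta ::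
  "('p, 'm::finite) tensor2 \<Rightarrow> ('p, 'm) tensor2 \<Rightarrow> ('x \<Rightarrow> 'p) \<Rightarrow> ('x, complex) chart \<Rightarrow>
   ('p, real ^ 'm) chart \<Rightarrow> nat \<Rightarrow> nat \<Rightarrow> complex \<Rightarrow> para_complexified" where
  "eta P g \<phi> z c \<alpha> \<beta> \<zeta> =
     (let f = local_rep \<phi> z c in
      q_complex (g c (f \<zeta>)) (P c (f \<zeta>))
        (iterated_derivative d_z (g c) f \<alpha> \<zeta>)
        (iterated_derivative d_zbar (g c) f \<beta> \<zeta>))"

definition isotropic_order ::
  "('x, complex) chart set \<Rightarrow> ('p, real ^ 'm) chart set \<Rightarrow>
   ('p, 'm) tensor2 \<Rightarrow> ('p, 'm) tensor2 \<Rightarrow> ('x \<Rightarrow> 'p) \<Rightarrow> enat" where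
  "isotropic_order \<X> \<A> P g \<phi> =
     (GREATEST \<gamma>::enat. \<gamma> \<ge> 1 \<and>
        (\<forall>\<alpha> \<beta>. \<alpha> \<ge> 1 \<and> \<beta> \<ge> 1 \<and> enat (\<alpha> + \<beta>) \<le> \<gamma> \<longrightarrow>
           (\<forall>z\<in>\<X>. \<forall>c\<in>\<A>. \<forall>\<zeta>\<in>local_dom \<phi> z c. eta P g \<phi> z c \<alpha> \<beta> \<zeta> = 0)))"

text \<open>Vanishing of \<open>\<partial>\<^bsub>zbar\<^esub>\<close>; differentiability is required explicitly because
  \<open>frechet_derivative\<close> carries no information without it.\<close>

definition holomorphic_coefficient :: "complex set \<Rightarrow> (complex \<Rightarrow> para_complexified) \<Rightarrow> bool" where
  "holomorphic_coefficient S h \<longleftrightarrow> (\<forall>\<zeta>\<in>S. h differentiable (at \<zeta>) \<and>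
     d_zbar (\<lambda>w. fst (h w)) \<zeta> = 0 \<and> d_zbar (\<lambda>w. snd (h w)) \<zeta> = 0)"

end

theory Submission
  imports Defs
begin

text \<open>
  Why the theorem holds. Write \<open>\<phi>\<^sub>k\<close> for \<open>\<phi>\<^bsub>z,k\<^esub>\<close>. Since \<open>\<phi>\<close> is real, \<open>\<phi>\<^bsub>zbar,k\<^esub>\<close> is the conjugate
  of \<open>\<phi>\<^sub>k\<close>, so the two components of \<open>\<eta>\<^bsub>\<alpha>,\<beta>\<^esub>\<close> are \<open>B(\<phi>\<^sub>\<alpha>, \<phi>\<^sub>\<beta>)\<close> with \<open>B\<close> the complex-bilinear
  extension of \<open>g\<close> or of the fundamental form \<open>\<omega> = g(\<cdot>, P \<cdot>)\<close>. Both forms are parallel: for \<open>\<omega>\<close>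
  this follows from \<open>d\<omega> = 0\<close> and the involutivity of the eigendistributions
  (\<open>covariant_A_zero\<close>). Hence \<open>B(\<phi>\<^sub>\<alpha>, \<phi>\<^sub>\<beta>)\<close> obeys the Leibniz rule (\<open>leibniz\<close>), and differentiating
  \<open>\<eta>\<^bsub>\<alpha>,\<beta>\<^esub> = 0\<close> with \<open>\<alpha> + \<beta> = \<gamma>\<close> by \<open>\<partial>\<^sub>z\<close> gives
  \<open>\<eta>\<^bsub>\<alpha>+1,\<beta>\<^esub> + \<eta>\<^bsub>\<alpha>,\<beta>+1\<^esub> = 0\<close>, which is (i) (\<open>pairing_antidiagonal\<close>).

  For (ii), \<open>\<partial>\<^bsub>zbar\<^esub> \<eta>\<^bsub>\<gamma>,1\<^esub> = B(\<nabla>\<^bsub>zbar\<^esub> \<phi>\<^sub>\<gamma>, \<phi>\<^sub>1)\<close> by harmonicity. More generally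
  \<open>B(\<nabla>\<^bsub>zbar\<^esub> \<phi>\<^sub>k, \<phi>\<^sub>\<beta>) = 0\<close> whenever \<open>k + \<beta> \<le> \<gamma> + 1\<close> (\<open>Dzbar_jet_orthogonal\<close>): by induction on
  \<open>k\<close>, commuting \<open>\<nabla>\<^bsub>zbar\<^esub>\<close> past \<open>\<nabla>\<^bsub>z\<^esub>\<close> produces the curvature term
  \<open>B(R(\<phi>\<^sub>1, \<phi>\<^bsub>zbar,1\<^esub>) \<phi>\<^sub>k, \<phi>\<^sub>\<beta>)\<close>. Constant para-holomorphic curvature determines \<open>R\<close>
  (\<open>K_eq\<close>), and every summand of the resulting formula contains one of the products \<open>g\<close> or \<open>\<omega>\<close> of two
  of the vectors \<open>\<phi>\<^sub>1\<close>, \<open>\<phi>\<^sub>k\<close>, \<open>\<phi>\<^sub>\<beta>\<close>; these vanish by isotropy (\<open>ccurv_isotropic\<close>).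

  The formula for \<open>R\<close> is obtained by splitting vectors along the \<open>\<plusminus>1\<close>-eigenspaces of \<open>P\<close>, which are
  isotropic for \<open>g\<close>: \<open>R\<close> is then given by a single function, symmetric in its two arguments from each
  eigenspace, whose diagonal values the para-holomorphic curvature prescribes. The symmetries of \<open>R\<close>
  themselves come from the same calculus of pulled-back sections, applied to affine maps of a plane
  into a chart and constant sections (\<open>curvature_parallel\<close>).
\<close>

section \<open>Calculus of smooth functions\<close>

lemma differentiable_imp_has_derivative:
  "f differentiable (at x) \<Longrightarrow> (f has_derivative frechet_derivative f (at x)) (at x)"
  using frechet_derivative_works by blast

lemma frechet_derivative_eqI:
  "(f has_derivative f') (at x) \<Longrightarrow> frechet_derivative f (at x) = f'"
  using frechet_derivative_at by metis

lemma frechet_derivative_cong_open: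
  assumes "open S" "x \<in> S" "\<And>y. y \<in> S \<Longrightarrow> f y = g y"
  shows "frechet_derivative f (at x) = frechet_derivative g (at x)"
proof -
  have "(f has_derivative f') (at x) \<longleftrightarrow> (g has_derivative f') (at x)" for f'
    using assms has_derivative_transform_within_open[OF _ assms(1,2), of f f' UNIV g]
      has_derivative_transform_within_open[OF _ assms(1,2), of g f' UNIV f] by auto
  then show ?thesis unfolding frechet_derivative_def by simp
qed

lemma differentiable_cong_open:
  assumes "open S" "x \<in> S" "\<And>y. y \<in> S \<Longrightarrow> f y = g y" "f differentiable (at x)"
  shows "g differentiable (at x)"
  using assms has_derivative_transform_within_open[OF _ assms(1,2), of f _ UNIV g]
  unfolding differentiable_def by auto

lemma k_smooth_on_cong:
  assumes "open S" "\<And>x. x \<in> S \<Longrightarrow> f x = g x" "k_smooth_on k S f"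
  shows "k_smooth_on k S g"
  using assms(2,3)
proof (induction k arbitrary: f g)
  case 0
  then show ?case by (simp cong: continuous_on_cong)
next
  case (Suc k)
  have "k_smooth_on k S (\<lambda>x. frechet_derivative g (at x) v)" for v
    using Suc.IH[of "\<lambda>x. frechet_derivative f (at x) v" "\<lambda>x. frechet_derivative g (at x) v"]
      frechet_derivative_cong_open[OF assms(1) _ Suc.prems(1)] Suc.prems(2) by simp
  then show ?case
    using Suc.prems differentiable_cong_open[OF assms(1) _ Suc.prems(1)] by simp
qed

lemma k_smooth_on_Suc_D:
  assumes "k_smooth_on (Suc k) S f"
  shows "k_smooth_on k S f"
  using assms
proof (induction k arbitrary: f)
  case 0
  then show ?case
    by (auto intro!: continuous_at_imp_continuous_on differentiable_imp_continuous_within)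
next
  case (Suc k)
  then show ?case by simp
qed

lemma k_smooth_on_const: "k_smooth_on k S (\<lambda>x. c)"
  by (induction k arbitrary: c) auto

lemma k_smooth_on_bounded_linear:
  assumes "open S" "bounded_linear L" "k_smooth_on k S f"
  shows "k_smooth_on k S (\<lambda>x. L (f x))"
  using assms(3)
proof (induction k arbitrary: f)
  case 0
  then show ?case using assms(2)
    by (auto intro: continuous_on_compose2[OF linear_continuous_on[OF assms(2)]])
next
  case (Suc k)
  have d: "((\<lambda>x. L (f x)) has_derivative (\<lambda>v. L (frechet_derivative f (at x) v))) (at x)"
    if "x \<in> S" for x
    using Suc.prems that
    by (auto intro!: bounded_linear.has_derivative[OF assms(2)] differentiable_imp_has_derivative)
  have "k_smooth_on k S (\<lambda>x. frechet_derivative (\<lambda>x. L (f x)) (at x) v)" for v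
    by (rule k_smooth_on_cong[OF assms(1) _ Suc.IH[of "\<lambda>x. frechet_derivative f (at x) v"]])
      (use Suc.prems frechet_derivative_eqI[OF d] in auto)
  with d show ?case by (auto intro: differentiableI)
qed

lemma k_smooth_on_add:
  assumes "open S" "k_smooth_on k S f" "k_smooth_on k S g"
  shows "k_smooth_on k S (\<lambda>x. f x + g x)"
  using assms(2,3)
proof (induction k arbitrary: f g)
  case 0
  then show ?case by (auto intro: continuous_intros)
next
  case (Suc k)
  have d: "((\<lambda>x. f x + g x) has_derivative
      (\<lambda>v. frechet_derivative f (at x) v + frechet_derivative g (at x) v)) (at x)"
    if "x \<in> S" for x
    using Suc.prems that by (auto intro!: has_derivative_add differentiable_imp_has_derivative)
  have "k_smooth_on k S (\<lambda>x. frechet_derivative (\<lambda>x. f x + g x) (at x) v)" for v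
    by (rule k_smooth_on_cong[OF assms(1) _ Suc.IH[of "\<lambda>x. frechet_derivative f (at x) v"
          "\<lambda>x. frechet_derivative g (at x) v"]])
      (use Suc.prems frechet_derivative_eqI[OF d] in auto)
  with d show ?case by (auto intro: differentiableI)
qed

lemma k_smooth_on_sum:
  assumes "open S" "\<And>i. i \<in> I \<Longrightarrow> k_smooth_on k S (f i)"
  shows "k_smooth_on k S (\<lambda>x. \<Sum>i\<in>I. f i x)"
  using assms(2)
  by (induction I rule: infinite_finite_induct)
    (auto intro: k_smooth_on_add[OF assms(1)] k_smooth_on_const)

lemma k_smooth_on_mult:
  fixes f g :: "_ \<Rightarrow> 'b::real_normed_algebra"
  assumes "open S" "k_smooth_on k S f" "k_smooth_on k S g"
  shows "k_smooth_on k S (\<lambda>x. f x * g x)"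
  using assms(2,3)
proof (induction k arbitrary: f g)
  case 0
  then show ?case by (auto intro: continuous_intros)
next
  case (Suc k)
  have d: "((\<lambda>x. f x * g x) has_derivative
      (\<lambda>v. f x * frechet_derivative g (at x) v + frechet_derivative f (at x) v * g x)) (at x)"
    if "x \<in> S" for x
    using Suc.prems that by (auto intro!: has_derivative_mult differentiable_imp_has_derivative)
  have fg: "k_smooth_on k S f" "k_smooth_on k S g"
    using Suc.prems k_smooth_on_Suc_D by blast+
  have "k_smooth_on k S (\<lambda>x. frechet_derivative (\<lambda>x. f x * g x) (at x) v)" for v
    by (rule k_smooth_on_cong[OF assms(1) _ k_smooth_on_add[OF assms(1)
            Suc.IH[OF fg(1), of "\<lambda>x. frechet_derivative g (at x) v"]
            Suc.IH[OF _ fg(2), of "\<lambda>x. frechet_derivative f (at x) v"]]])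
      (use Suc.prems frechet_derivative_eqI[OF d] in auto)
  with d show ?case by (auto intro: differentiableI)
qed

lemma k_smooth_on_inverse:
  fixes f :: "_ \<Rightarrow> real"
  assumes "open S" "\<And>x. x \<in> S \<Longrightarrow> f x \<noteq> 0" "k_smooth_on k S f"
  shows "k_smooth_on k S (\<lambda>x. inverse (f x))"
  using assms(3)
proof (induction k)
  case 0
  then show ?case using assms(2) by (auto intro: continuous_intros)
next
  case (Suc k)
  have d: "((\<lambda>x. inverse (f x)) has_derivative
      (\<lambda>v. - (inverse (f x) * frechet_derivative f (at x) v * inverse (f x)))) (at x)"
    if "x \<in> S" for x
    using Suc.prems by (intro Deriv.has_derivative_inverse assms(2) that
        differentiable_imp_has_derivative) (simp add: that)
  have i: "k_smooth_on k S (\<lambda>x. inverse (f x))"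
    using Suc k_smooth_on_Suc_D by blast
  have "k_smooth_on k S (\<lambda>x. frechet_derivative (\<lambda>x. inverse (f x)) (at x) v)" for v
    by (rule k_smooth_on_cong[OF assms(1) _ k_smooth_on_bounded_linear[OF assms(1)
            bounded_linear_minus[OF bounded_linear_ident]
            k_smooth_on_mult[OF assms(1) k_smooth_on_mult[OF assms(1) i,
                of "\<lambda>x. frechet_derivative f (at x) v"] i]]])
      (use Suc.prems frechet_derivative_eqI[OF d] in auto)
  with d show ?case by (auto intro: differentiableI)
qed

lemma linear_expand_Basis:
  fixes L :: "'e::euclidean_space \<Rightarrow> 'b::real_vector"
  assumes "linear L"
  shows "L w = (\<Sum>b\<in>Basis. (w \<bullet> b) *\<^sub>R L b)"
proof -
  have "L w = L (\<Sum>b\<in>Basis. (w \<bullet> b) *\<^sub>R b)" by (simp add: euclidean_representation)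
  also have "\<dots> = (\<Sum>b\<in>Basis. (w \<bullet> b) *\<^sub>R L b)"
    by (simp add: linear_sum[OF assms] linear_cmul[OF assms])
  finally show ?thesis .
qed

lemma k_smooth_on_compose:
  fixes h :: "'e::euclidean_space \<Rightarrow> real" and f :: "'a::real_normed_vector \<Rightarrow> 'e"
  assumes "open S" "f ` S \<subseteq> T" "k_smooth_on k T h" "k_smooth_on k S f"
  shows "k_smooth_on k S (\<lambda>x. h (f x))"
  using assms(3,4)
proof (induction k arbitrary: h)
  case 0
  then show ?case using assms(2) by (auto intro: continuous_on_compose2)
next
  case (Suc k)
  have d: "((\<lambda>x. h (f x)) has_derivative
      (\<lambda>v. frechet_derivative h (at (f x)) (frechet_derivative f (at x) v))) (at x)"
    if "x \<in> S" for x
    using Suc.prems that assms(2)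
    by (auto intro!: has_derivative_compose[of f _ x UNIV h] differentiable_imp_has_derivative)
  have f: "k_smooth_on k S f"
    using Suc.prems k_smooth_on_Suc_D by blast
  have e: "(\<Sum>b\<in>Basis. frechet_derivative h (at (f x)) b * (frechet_derivative f (at x) v \<bullet> b)) =
    frechet_derivative (\<lambda>x. h (f x)) (at x) v" if "x \<in> S" for x v
  proof -
    have "linear (frechet_derivative h (at (f x)))"
      using Suc.prems that assms(2) linear_frechet_derivative by auto
    from linear_expand_Basis[OF this, of "frechet_derivative f (at x) v"]
    show ?thesis using frechet_derivative_eqI[OF d[OF that]] by (simp add: mult.commute)
  qed
  have "k_smooth_on k S (\<lambda>x. \<Sum>b\<in>Basis. frechet_derivative h (at (f x)) b
      * (frechet_derivative f (at x) v \<bullet> b))" for v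
    using Suc.prems f
    by (intro k_smooth_on_sum k_smooth_on_mult assms(1) Suc.IH
        k_smooth_on_bounded_linear[OF assms(1) bounded_linear_inner_left]) auto
  from k_smooth_on_cong[OF assms(1) e this]
  have "k_smooth_on k S (\<lambda>x. frechet_derivative (\<lambda>x. h (f x)) (at x) v)" for v .
  with d show ?case by (auto intro: differentiableI)
qed

lemma smooth_on_differentiable: "smooth_on S f \<Longrightarrow> x \<in> S \<Longrightarrow> f differentiable (at x)"
  unfolding smooth_on_def using k_smooth_on.simps(2) by blast

lemma smooth_on_frechet:
  "smooth_on S f \<Longrightarrow> smooth_on S (\<lambda>x. frechet_derivative f (at x) v)"
  unfolding smooth_on_def using k_smooth_on.simps(2) by blast

lemma smooth_on_continuous: "smooth_on S f \<Longrightarrow> continuous_on S f"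
  unfolding smooth_on_def using k_smooth_on.simps(1) by blast

lemma smooth_on_const: "smooth_on S (\<lambda>x. c)"
  unfolding smooth_on_def by (simp add: k_smooth_on_const)

lemma smooth_on_cong:
  "open S \<Longrightarrow> (\<And>x. x \<in> S \<Longrightarrow> f x = g x) \<Longrightarrow> smooth_on S f \<Longrightarrow> smooth_on S g"
  unfolding smooth_on_def by (rule allI, rule k_smooth_on_cong[of S f g]) auto

lemma smooth_on_bounded_linear:
  "open S \<Longrightarrow> bounded_linear L \<Longrightarrow> smooth_on S f \<Longrightarrow> smooth_on S (\<lambda>x. L (f x))"
  unfolding smooth_on_def by (rule allI, rule k_smooth_on_bounded_linear[where L = L]) auto

lemma smooth_on_add:
  "open S \<Longrightarrow> smooth_on S f \<Longrightarrow> smooth_on S g \<Longrightarrow> smooth_on S (\<lambda>x. f x + g x)"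
  unfolding smooth_on_def by (rule allI, rule k_smooth_on_add) auto

lemma smooth_on_diff:
  assumes "open S" "smooth_on S f" "smooth_on S g"
  shows "smooth_on S (\<lambda>x. f x - g x)"
  using smooth_on_add[OF assms(1,2)
      smooth_on_bounded_linear[OF assms(1) bounded_linear_minus[OF bounded_linear_ident] assms(3)]]
  by simp

lemma smooth_on_sum:
  "open S \<Longrightarrow> (\<And>i. i \<in> I \<Longrightarrow> smooth_on S (f i)) \<Longrightarrow> smooth_on S (\<lambda>x. \<Sum>i\<in>I. f i x)"
  unfolding smooth_on_def by (rule allI, rule k_smooth_on_sum) auto

lemma smooth_on_mult:
  fixes f g :: "_ \<Rightarrow> 'b::real_normed_algebra"
  shows "open S \<Longrightarrow> smooth_on S f \<Longrightarrow> smooth_on S g \<Longrightarrow> smooth_on S (\<lambda>x. f x * g x)"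
  unfolding smooth_on_def by (rule allI, rule k_smooth_on_mult) auto

lemma smooth_on_prod:
  fixes f :: "_ \<Rightarrow> _ \<Rightarrow> real"
  assumes "open S" "\<And>i. i \<in> I \<Longrightarrow> smooth_on S (f i)"
  shows "smooth_on S (\<lambda>x. \<Prod>i\<in>I. f i x)"
  using assms(2)
  by (induction I rule: infinite_finite_induct)
    (auto intro: smooth_on_mult[OF assms(1)] smooth_on_const)

lemma smooth_on_inverse:
  fixes f :: "_ \<Rightarrow> real"
  shows "open S \<Longrightarrow> (\<And>x. x \<in> S \<Longrightarrow> f x \<noteq> 0) \<Longrightarrow> smooth_on S f \<Longrightarrow> smooth_on S (\<lambda>x. inverse (f x))"
  unfolding smooth_on_def by (rule allI, rule k_smooth_on_inverse) auto

lemma smooth_on_compose: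
  fixes h :: "'e::euclidean_space \<Rightarrow> real"
  shows "open S \<Longrightarrow> f ` S \<subseteq> T \<Longrightarrow> smooth_on T h \<Longrightarrow> smooth_on S f \<Longrightarrow> smooth_on S (\<lambda>x. h (f x))"
  unfolding smooth_on_def by (rule allI, rule k_smooth_on_compose[where T = T and h = h and f = f]) auto

lemma smooth_on_id: "smooth_on S (\<lambda>x. x)"
proof -
  have "k_smooth_on k S (\<lambda>x. x)" for k
    by (cases k) (auto simp: k_smooth_on_const)
  then show ?thesis unfolding smooth_on_def by blast
qed

lemma smooth_on_nth:
  fixes f :: "_ \<Rightarrow> ('b::real_normed_vector) ^ 'n"
  shows "open S \<Longrightarrow> smooth_on S f \<Longrightarrow> smooth_on S (\<lambda>x. f x $ i)"
  by (rule smooth_on_bounded_linear[OF _ bounded_linear_vec_nth])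

lemma smooth_on_of_real:
  "open S \<Longrightarrow> smooth_on S f \<Longrightarrow> smooth_on S (\<lambda>x. complex_of_real (f x))"
  by (rule smooth_on_bounded_linear[OF _ bounded_linear_of_real])

lemma smooth_on_det:
  fixes G :: "'a::real_normed_vector \<Rightarrow> real ^ 'n ^ 'n"
  assumes "open S" "\<And>i j. smooth_on S (\<lambda>x. G x $ i $ j)"
  shows "smooth_on S (\<lambda>x. det (G x))"
  unfolding det_def
  by (rule smooth_on_sum[OF assms(1)], rule smooth_on_mult[OF assms(1) smooth_on_const],
      rule smooth_on_prod[OF assms(1)], rule assms(2))

lemma matrix_mul_inv_right:
  fixes M :: "real ^ 'n ^ 'n"
  assumes "det M \<noteq> 0"
  shows "M ** matrix_inv M = mat 1"
proof -
  have "invertible M" using assms invertible_det_nz by blast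
  then show ?thesis
    unfolding invertible_def matrix_inv_def by (rule someI2_ex) simp
qed

lemma matrix_inv_cramer:
  fixes M :: "real ^ 'n ^ 'n"
  assumes "det M \<noteq> 0"
  shows "matrix_inv M $ k $ l =
    det (\<chi> i j. if j = k then axis l 1 $ i else M $ i $ j) * inverse (det M)"
proof -
  have "M *v (matrix_inv M *v axis l 1) = axis l 1"
    by (simp add: matrix_vector_mul_assoc matrix_mul_inv_right[OF assms])
  then have "matrix_inv M *v axis l 1 =
      (\<chi> k. det (\<chi> i j. if j = k then axis l 1 $ i else M $ i $ j) / det M)"
    using cramer[OF assms] by blast
  moreover have "(matrix_inv M *v axis l 1) $ k = matrix_inv M $ k $ l"
    by (simp add: matrix_vector_mult_basis column_def)
  ultimately show ?thesis by (simp add: divide_inverse)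
qed

text \<open>By Cramer's rule the entries of the inverse are rational functions of the entries.\<close>

lemma smooth_on_matrix_inv:
  fixes G :: "'a::real_normed_vector \<Rightarrow> real ^ 'n ^ 'n"
  assumes "open S" "\<And>i j. smooth_on S (\<lambda>x. G x $ i $ j)" "\<And>x. x \<in> S \<Longrightarrow> det (G x) \<noteq> 0"
  shows "smooth_on S (\<lambda>x. matrix_inv (G x) $ k $ l)"
proof (rule smooth_on_cong[OF assms(1)])
  show "det (\<chi> i j. if j = k then axis l 1 $ i else G x $ i $ j) * inverse (det (G x))
      = matrix_inv (G x) $ k $ l" if "x \<in> S" for x
    using matrix_inv_cramer[OF assms(3)[OF that]] by simp
  have "smooth_on S (\<lambda>x. (\<chi> i j. if j = k then axis l 1 $ i else G x $ i $ j) $ i $ j)" for i j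
    using assms(2) by (cases "j = k") (simp_all add: smooth_on_const)
  then show "smooth_on S (\<lambda>x. det (\<chi> i j. if j = k then axis l 1 $ i else G x $ i $ j)
      * inverse (det (G x)))"
    using assms by (intro smooth_on_mult smooth_on_inverse smooth_on_det) auto
qed

text \<open>The mean value theorem along \<open>u\<close>, followed by the mean value theorem along \<open>v\<close>.\<close>

lemma second_difference:
  fixes F :: "'a::real_normed_vector \<Rightarrow> real"
  assumes "h > 0"
    and in_S: "\<And>s t. 0 \<le> s \<Longrightarrow> s \<le> h \<Longrightarrow> 0 \<le> t \<Longrightarrow> t \<le> h \<Longrightarrow> x + s *\<^sub>R u + t *\<^sub>R v \<in> S"
    and dF: "\<And>y. y \<in> S \<Longrightarrow> F differentiable (at y)"
    and dFu: "\<And>y. y \<in> S \<Longrightarrow> (\<lambda>y. frechet_derivative F (at y) u) differentiable (at y)"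
  shows "\<exists>s t. 0 \<le> s \<and> s \<le> h \<and> 0 \<le> t \<and> t \<le> h \<and>
     F (x + h *\<^sub>R u + h *\<^sub>R v) - F (x + h *\<^sub>R u) - F (x + h *\<^sub>R v) + F x = h * h *
       frechet_derivative (\<lambda>y. frechet_derivative F (at y) u) (at (x + s *\<^sub>R u + t *\<^sub>R v)) v"
proof -
  let ?Fu = "\<lambda>y. frechet_derivative F (at y) u"
  have line: "((\<lambda>s. F (y + s *\<^sub>R w)) has_derivative
      (\<lambda>r. frechet_derivative F (at (y + s *\<^sub>R w)) (r *\<^sub>R w))) (at s within T)"
    if "F differentiable (at (y + s *\<^sub>R w))" for F :: "'a \<Rightarrow> real" and y w s T
  proof (rule has_derivative_compose[where f = "\<lambda>s. y + s *\<^sub>R w" and g = F and f' = "\<lambda>r. r *\<^sub>R w"])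
    show "(F has_derivative frechet_derivative F (at (y + s *\<^sub>R w))) (at (y + s *\<^sub>R w))"
      by (rule differentiable_imp_has_derivative[OF that])
    have "((\<lambda>s. y + s *\<^sub>R w) has_derivative (\<lambda>r. 0 + r *\<^sub>R w)) (at s within T)"
      by (intro has_derivative_add has_derivative_const has_derivative_scaleR_left has_derivative_ident)
    then show "((\<lambda>s. y + s *\<^sub>R w) has_derivative (\<lambda>r. r *\<^sub>R w)) (at s within T)" by simp
  qed
  have "\<exists>s\<in>{0<..<h}. (F (x + h *\<^sub>R v + h *\<^sub>R u) - F (x + h *\<^sub>R u))
      - (F (x + h *\<^sub>R v + 0 *\<^sub>R u) - F (x + 0 *\<^sub>R u)) =
    frechet_derivative F (at (x + h *\<^sub>R v + s *\<^sub>R u)) ((h - 0) *\<^sub>R u)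
     - frechet_derivative F (at (x + s *\<^sub>R u)) ((h - 0) *\<^sub>R u)"
  proof (rule mvt_simple[OF assms(1),
        where f = "\<lambda>s. F (x + h *\<^sub>R v + s *\<^sub>R u) - F (x + s *\<^sub>R u)"])
    fix s :: real
    assume "0 \<le> s" "s \<le> h"
    then have "x + h *\<^sub>R v + s *\<^sub>R u \<in> S" "x + s *\<^sub>R u \<in> S"
      using in_S[of s h] in_S[of s 0] \<open>h > 0\<close> by (simp_all add: add.assoc add.commute[of "h *\<^sub>R v"])
    then show "((\<lambda>s. F (x + h *\<^sub>R v + s *\<^sub>R u) - F (x + s *\<^sub>R u)) has_derivative
        (\<lambda>r. frechet_derivative F (at (x + h *\<^sub>R v + s *\<^sub>R u)) (r *\<^sub>R u)
          - frechet_derivative F (at (x + s *\<^sub>R u)) (r *\<^sub>R u))) (at s within {0..h})"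
      by (intro has_derivative_diff line dF)
  qed
  then obtain s where "s \<in> {0<..<h}" and
    e: "(F (x + h *\<^sub>R v + h *\<^sub>R u) - F (x + h *\<^sub>R u))
      - (F (x + h *\<^sub>R v + 0 *\<^sub>R u) - F (x + 0 *\<^sub>R u)) =
    frechet_derivative F (at (x + h *\<^sub>R v + s *\<^sub>R u)) ((h - 0) *\<^sub>R u)
     - frechet_derivative F (at (x + s *\<^sub>R u)) ((h - 0) *\<^sub>R u)" by blast
  then have s: "0 \<le> s" "s \<le> h" by auto
  have eq1: "(F (x + h *\<^sub>R u + h *\<^sub>R v) - F (x + h *\<^sub>R u)) - (F (x + h *\<^sub>R v) - F x) =
     frechet_derivative F (at (x + s *\<^sub>R u + h *\<^sub>R v)) (h *\<^sub>R u)
     - frechet_derivative F (at (x + s *\<^sub>R u)) (h *\<^sub>R u)"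
    using e by (simp add: add.assoc add.commute[of "h *\<^sub>R v"])
  have hu: "frechet_derivative F (at y) (h *\<^sub>R u) = h * ?Fu y" if "y \<in> S" for y
    using linear_cmul[OF linear_frechet_derivative[OF dF[OF that]]] by simp
  have "\<exists>t\<in>{0<..<h}. ?Fu (x + s *\<^sub>R u + h *\<^sub>R v) - ?Fu (x + s *\<^sub>R u + 0 *\<^sub>R v) =
     frechet_derivative ?Fu (at (x + s *\<^sub>R u + t *\<^sub>R v)) ((h - 0) *\<^sub>R v)"
    by (rule mvt_simple[OF assms(1), where f = "\<lambda>t. ?Fu (x + s *\<^sub>R u + t *\<^sub>R v)"], rule line)
      (rule dFu, use in_S s in blast)
  then obtain t where "t \<in> {0<..<h}" and
    e: "?Fu (x + s *\<^sub>R u + h *\<^sub>R v) - ?Fu (x + s *\<^sub>R u + 0 *\<^sub>R v) =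
     frechet_derivative ?Fu (at (x + s *\<^sub>R u + t *\<^sub>R v)) ((h - 0) *\<^sub>R v)" by blast
  then have t: "0 \<le> t" "t \<le> h" by auto
  have eq2: "?Fu (x + s *\<^sub>R u + h *\<^sub>R v) - ?Fu (x + s *\<^sub>R u) =
     frechet_derivative ?Fu (at (x + s *\<^sub>R u + t *\<^sub>R v)) (h *\<^sub>R v)" using e by simp
  have "frechet_derivative ?Fu (at (x + s *\<^sub>R u + t *\<^sub>R v)) (h *\<^sub>R v) =
    h * frechet_derivative ?Fu (at (x + s *\<^sub>R u + t *\<^sub>R v)) v"
    using linear_cmul[OF linear_frechet_derivative[OF dFu[OF in_S[OF s t]]]] by simp
  moreover have "frechet_derivative F (at (x + s *\<^sub>R u + h *\<^sub>R v)) (h *\<^sub>R u)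
      = h * ?Fu (x + s *\<^sub>R u + h *\<^sub>R v)"
    "frechet_derivative F (at (x + s *\<^sub>R u)) (h *\<^sub>R u) = h * ?Fu (x + s *\<^sub>R u)"
    using hu[OF in_S[OF s, of h]] hu[OF in_S[OF s, of 0]] \<open>h > 0\<close> by simp_all
  ultimately have "(F (x + h *\<^sub>R u + h *\<^sub>R v) - F (x + h *\<^sub>R u)) - (F (x + h *\<^sub>R v) - F x) = h * (h *
       frechet_derivative ?Fu (at (x + s *\<^sub>R u + t *\<^sub>R v)) v)"
    using eq1 eq2 by (simp only: right_diff_distrib[symmetric])
  then have "F (x + h *\<^sub>R u + h *\<^sub>R v) - F (x + h *\<^sub>R u) - F (x + h *\<^sub>R v) + F x = h * h *
       frechet_derivative ?Fu (at (x + s *\<^sub>R u + t *\<^sub>R v)) v"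
    by simp
  with s t show ?thesis by blast
qed

text \<open>Schwarz's theorem: both iterated derivatives are limits of the same second difference.\<close>

lemma frechet_derivative_commute_real:
  fixes F :: "'a::real_normed_vector \<Rightarrow> real"
  assumes "open S" "x \<in> S" "smooth_on S F"
  shows "frechet_derivative (\<lambda>y. frechet_derivative F (at y) u) (at x) v =
         frechet_derivative (\<lambda>y. frechet_derivative F (at y) v) (at x) u"
proof (rule ccontr)
  define a where "a = (\<lambda>y. frechet_derivative (\<lambda>y. frechet_derivative F (at y) u) (at y) v)"
  define b where "b = (\<lambda>y. frechet_derivative (\<lambda>y. frechet_derivative F (at y) v) (at y) u)"
  assume "\<not> ?thesis"
  then have ab: "\<bar>a x - b x\<bar> > 0" by (simp add: a_def b_def)
  define \<epsilon> where "\<epsilon> = \<bar>a x - b x\<bar> / 2"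
  have "\<epsilon> > 0" using ab by (simp add: \<epsilon>_def)
  have "smooth_on S a" "smooth_on S b"
    unfolding a_def b_def by (intro smooth_on_frechet assms(3))+
  then have "isCont a x" "isCont b x"
    using assms(1,2) smooth_on_continuous continuous_on_eq_continuous_at by blast+
  then obtain d1 d2 where d: "d1 > 0" "\<And>y. dist y x < d1 \<Longrightarrow> dist (a y) (a x) < \<epsilon>"
     "d2 > 0" "\<And>y. dist y x < d2 \<Longrightarrow> dist (b y) (b x) < \<epsilon>"
    using \<open>\<epsilon> > 0\<close> unfolding continuous_at_eps_delta by metis
  obtain d3 where d3: "d3 > 0" "\<And>y. dist y x < d3 \<Longrightarrow> y \<in> S"
    using assms(1,2) open_dist by metis
  define d where "d = Min {d1, d2, d3}"
  have "d > 0" "d \<le> d1" "d \<le> d2" "d \<le> d3" using d d3 by (auto simp: d_def)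
  define N where "N = norm u + norm v + 1"
  define h where "h = d / N / 2"
  have np: "N > 0" using norm_ge_zero[of u] norm_ge_zero[of v] unfolding N_def by linarith
  have "h > 0" using \<open>d > 0\<close> np by (simp add: h_def)
  have close: "dist (x + s *\<^sub>R u + t *\<^sub>R v) x < d"
    if "0 \<le> s" "s \<le> h" "0 \<le> t" "t \<le> h" for s t
  proof -
    have "dist (x + s *\<^sub>R u + t *\<^sub>R v) x = norm (s *\<^sub>R u + t *\<^sub>R v)"
      by (simp add: dist_norm add.assoc)
    also have "\<dots> \<le> s * norm u + t * norm v"
      using norm_triangle_ineq[of "s *\<^sub>R u" "t *\<^sub>R v"] that by simp
    also have "\<dots> \<le> h * norm u + h * norm v"
      using that by (intro add_mono mult_right_mono) auto
    also have "\<dots> \<le> h * N" using \<open>h > 0\<close> by (simp add: N_def algebra_simps)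
    also have "\<dots> = d / 2" using np by (simp add: h_def)
    also have "\<dots> < d" using \<open>d > 0\<close> by simp
    finally show ?thesis .
  qed
  have inS: "x + s *\<^sub>R u + t *\<^sub>R v \<in> S" if "0 \<le> s" "s \<le> h" "0 \<le> t" "t \<le> h" for s t
    using close[OF that] d3(2) \<open>d \<le> d3\<close> by fastforce
  have inS': "x + s *\<^sub>R v + t *\<^sub>R u \<in> S" if "0 \<le> s" "s \<le> h" "0 \<le> t" "t \<le> h" for s t
    using inS[OF that(3,4,1,2)] by (simp add: add_ac)
  have diff: "\<And>y. y \<in> S \<Longrightarrow> F differentiable (at y)"
    "\<And>y w. y \<in> S \<Longrightarrow> (\<lambda>y. frechet_derivative F (at y) w) differentiable (at y)"
    using smooth_on_differentiable smooth_on_frechet assms(3) by blast+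
  obtain s t where st: "0 \<le> s" "s \<le> h" "0 \<le> t" "t \<le> h" and
    A: "F (x + h *\<^sub>R u + h *\<^sub>R v) - F (x + h *\<^sub>R u) - F (x + h *\<^sub>R v) + F x
       = h * h * a (x + s *\<^sub>R u + t *\<^sub>R v)"
    using second_difference[OF \<open>h > 0\<close> inS diff(1) diff(2)] unfolding a_def by blast
  obtain s' t' where st': "0 \<le> s'" "s' \<le> h" "0 \<le> t'" "t' \<le> h" and
    B: "F (x + h *\<^sub>R v + h *\<^sub>R u) - F (x + h *\<^sub>R v) - F (x + h *\<^sub>R u) + F x
       = h * h * b (x + s' *\<^sub>R v + t' *\<^sub>R u)"
    using second_difference[OF \<open>h > 0\<close> inS' diff(1) diff(2)] unfolding b_def by blast
  have "F (x + h *\<^sub>R v + h *\<^sub>R u) = F (x + h *\<^sub>R u + h *\<^sub>R v)" by (simp add: add_ac)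
  with A B have "h * h * a (x + s *\<^sub>R u + t *\<^sub>R v) = h * h * b (x + s' *\<^sub>R v + t' *\<^sub>R u)" by linarith
  then have "a (x + s *\<^sub>R u + t *\<^sub>R v) = b (x + s' *\<^sub>R v + t' *\<^sub>R u)"
    using \<open>h > 0\<close> by simp
  moreover have "dist (a (x + s *\<^sub>R u + t *\<^sub>R v)) (a x) < \<epsilon>"
    using d(2) close[OF st] \<open>d \<le> d1\<close> by fastforce
  moreover have "dist (b (x + s' *\<^sub>R v + t' *\<^sub>R u)) (b x) < \<epsilon>"
    using d(4) close[OF st'(3,4,1,2)] \<open>d \<le> d2\<close> by (fastforce simp: add_ac)
  ultimately show False unfolding \<epsilon>_def dist_real_def by (smt (verit) field_sum_of_halves)
qed

lemma frechet_derivative_bounded_linear: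
  assumes "bounded_linear L" "f differentiable (at x)"
  shows "frechet_derivative (\<lambda>x. L (f x)) (at x) v = L (frechet_derivative f (at x) v)"
  using frechet_derivative_eqI[OF bounded_linear.has_derivative[OF assms(1)
      differentiable_imp_has_derivative[OF assms(2)]]] by simp

lemma frechet_derivative_commute:
  fixes F :: "'a::real_normed_vector \<Rightarrow> complex"
  assumes "open S" "x \<in> S" "smooth_on S F"
  shows "frechet_derivative (\<lambda>y. frechet_derivative F (at y) u) (at x) v =
         frechet_derivative (\<lambda>y. frechet_derivative F (at y) v) (at x) u"
proof -
  have *: "L (frechet_derivative (\<lambda>y. frechet_derivative F (at y) u) (at x) v) =
         L (frechet_derivative (\<lambda>y. frechet_derivative F (at y) v) (at x) u)"
    if L: "bounded_linear L" for L :: "complex \<Rightarrow> real"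
  proof -
    have e: "L (frechet_derivative (\<lambda>y. frechet_derivative F (at y) u) (at x) v) =
      frechet_derivative (\<lambda>y. frechet_derivative (\<lambda>z. L (F z)) (at y) u) (at x) v" for u v
    proof -
      have "frechet_derivative (\<lambda>y. frechet_derivative (\<lambda>z. L (F z)) (at y) u) (at x) =
         frechet_derivative (\<lambda>y. L (frechet_derivative F (at y) u)) (at x)"
        by (rule frechet_derivative_cong_open[OF assms(1,2)])
          (simp add: frechet_derivative_bounded_linear[OF L] smooth_on_differentiable[OF assms(3)])
      then show ?thesis
        using frechet_derivative_bounded_linear[OF L
            smooth_on_differentiable[OF smooth_on_frechet[OF assms(3)] assms(2)]] by simp
    qed
    show ?thesis unfolding e
      by (rule frechet_derivative_commute_real[OF assms(1,2)
            smooth_on_bounded_linear[OF assms(1) L assms(3)]])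
  qed
  show ?thesis
    using *[OF bounded_linear_Re] *[OF bounded_linear_Im] by (simp add: complex_eq_iff)
qed

section \<open>Para-Hermitian linear algebra\<close>

text \<open>The algebraic half of the statement that a para-Kaehler structure is parallel. Rewriting both
  terms on the left of the integrability condition by the cyclic identity turns it into
  \<open>2 T z x (P y) = 0\<close>.\<close>

lemma torsion_free_form_vanishes:
  fixes T :: "'v \<Rightarrow> 'v \<Rightarrow> 'v \<Rightarrow> real" and P :: "'v \<Rightarrow> 'v"
  assumes skew: "\<And>x y z. T x y z = - T x z y"
    and T_P: "\<And>x y z. T x (P y) z = T x y (P z)"
    and closed: "\<And>x y z. T x y z + T y z x + T z x y = 0"
    and integrable: "\<And>x y z. T (P x) z y - T (P y) z x = T y (P z) x - T x (P z) y"
    and P_P: "\<And>x. P (P x) = x"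
  shows "T z x y = 0"
proof -
  have "T z x (P y) = 0" for x y z
    using closed[of "P x" z y] closed[of "P y" z x] integrable[of x z y]
      skew[of z y "P x"] skew[of z x "P y"] T_P[of z x y] T_P[of x y z] T_P[of y x z]
      skew[of y "P x" z] skew[of x "P y" z] skew[of x "P z" y] skew[of y "P z" x]
      skew[of x y "P z"] skew[of y x "P z"]
    by linarith
  from this[of z x "P y"] show ?thesis by (simp add: P_P)
qed

locale para_hermitian_form =
  fixes g :: "'v::real_vector \<Rightarrow> 'v \<Rightarrow> real" and P :: "'v \<Rightarrow> 'v"
  assumes linear_g: "\<And>y. linear (\<lambda>x. g x y)"
    and g_sym: "g x y = g y x"
    and nondegenerate: "(\<And>y. g x y = 0) \<Longrightarrow> x = 0"
    and linear_P: "linear P"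
    and P_P: "P (P x) = x"
    and g_P_P: "g (P x) (P y) = - g x y"
begin

lemma g_simps:
  "g (x + x') y = g x y + g x' y" "g x (y + y') = g x y + g x y'"
  "g (r *\<^sub>R x) y = r * g x y" "g x (r *\<^sub>R y) = r * g x y"
  "g (x - x') y = g x y - g x' y" "g x (y - y') = g x y - g x y'"
  "g (- x) y = - g x y" "g x (- y) = - g x y" "g 0 y = 0"
proof -
  show l: "g (x + x') y = g x y + g x' y" "g (r *\<^sub>R x) y = r * g x y" "g (x - x') y = g x y - g x' y"
    "g (- x) y = - g x y" "g 0 y = 0" for x x' y r
    using linear_add[OF linear_g] linear_scale[OF linear_g] linear_diff[OF linear_g]
      linear_neg[OF linear_g] linear_0[OF linear_g] by simp_all
  show "g x (y + y') = g x y + g x y'" "g x (r *\<^sub>R y) = r * g x y"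
    "g x (y - y') = g x y - g x y'" "g x (- y) = - g x y"
    by (simp_all add: g_sym[of x] l)
qed

lemma P_simps:
  "P (x + y) = P x + P y" "P (r *\<^sub>R x) = r *\<^sub>R P x" "P (x - y) = P x - P y" "P (- x) = - P x"
  using linear_P by (simp_all add: linear_add linear_scale linear_diff linear_neg)

lemma g_P_left: "g (P x) y = - g x (P y)"
  using g_P_P[of x "P y"] by (simp add: P_P)

text \<open>The pairing of the component of \<open>x\<close> in the \<open>1\<close>-eigenspace of \<open>P\<close> with the component of
  \<open>y\<close> in the \<open>-1\<close>-eigenspace.\<close>

definition mixed :: "'v \<Rightarrow> 'v \<Rightarrow> real" where
  "mixed x y = (g x y - g x (P y)) / 2"

lemma isotropic_eigenspaces:
  assumes "P a = s *\<^sub>R a" "P c = s *\<^sub>R c" "s * s = 1"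
  shows "g a c = 0"
  using g_P_P[of a c] assms by (simp add: g_simps flip: mult.assoc)

lemma eigen_decomposition:
  obtains a b where "x = a + b" "P a = a" "P b = - b"
proof
  show "x = (1/2) *\<^sub>R (x + P x) + (1/2) *\<^sub>R (x - P x)"
    by (simp add: algebra_simps flip: scaleR_2)
qed (simp_all add: P_simps P_P algebra_simps)

lemma mixed_decomposed:
  assumes "P a = a" "P b = - b" "P c = c" "P d = - d"
  shows "mixed (a + b) (c + d) = g a d"
  using isotropic_eigenspaces[of a 1 c] isotropic_eigenspaces[of b "-1" d] assms
  by (simp add: mixed_def g_simps P_simps)

lemma mixed_P_right: "mixed x (P y) = - mixed x y"
  by (simp add: mixed_def P_P field_simps)

lemma mixed_P_left: "mixed (P x) y = mixed x y"
  by (simp add: mixed_def g_P_left P_P)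

end

text \<open>An algebraic curvature tensor of a para-Kaehler vector space, \<open>K x y z w\<close> being
  \<open>g(R(x, y)z, w)\<close>.\<close>

locale para_kaehler_curvature_form = para_hermitian_form g P
  for g :: "'v::real_vector \<Rightarrow> 'v \<Rightarrow> real" and P +
  fixes K :: "'v \<Rightarrow> 'v \<Rightarrow> 'v \<Rightarrow> 'v \<Rightarrow> real" and \<kappa> :: real
  assumes linear_K: "linear (\<lambda>x. K x y z w)" "linear (\<lambda>z. K x y z w)"
    and K_skew12: "K x y z w = - K y x z w"
    and K_skew34: "K x y z w = - K x y w z"
    and bianchi: "K x y z w + K y z x w + K z x y w = 0"
    and K_P_P: "K x y (P z) (P w) = - K x y z w"
    and para_holomorphic:
      "g v v \<noteq> 0 \<Longrightarrow> K v (P v) (P v) v = \<kappa> * (g v v * g (P v) (P v) - (g v (P v))\<^sup>2)"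
begin

lemma K_pair: "K x y z w = K z w x y"
  using bianchi[of x y z w] bianchi[of y z w x] bianchi[of z w x y] bianchi[of w x y z]
    K_skew34[of x y z w] K_skew34[of y z x w] K_skew12[of z x y w] K_skew34[of x z y w]
    K_skew34[of z w y x] K_skew12[of w y z x] K_skew34[of y w z x] K_skew34[of w x z y]
  by linarith

lemma K_add:
  "K (x + x') y z w = K x y z w + K x' y z w"
  "K x (y + y') z w = K x y z w + K x y' z w"
  "K x y (z + z') w = K x y z w + K x y z' w"
  "K x y z (w + w') = K x y z w + K x y z w'"
proof -
  show *: "K (x + x') y z w = K x y z w + K x' y z w" for x x' y z w
    by (rule linear_add[OF linear_K(1)])
  show "K x (y + y') z w = K x y z w + K x y' z w"
    using *[of y y' x z w] K_skew12 by (metis minus_add_distrib)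
  show **: "K x y (z + z') w = K x y z w + K x y z' w" for x y z z' w
    by (rule linear_add[OF linear_K(2)])
  show "K x y z (w + w') = K x y z w + K x y z w'"
    using **[of x y w w' z] K_skew34 by (metis minus_add_distrib)
qed

lemma K_scale:
  "K (r *\<^sub>R x) y z w = r * K x y z w"
  "K x (r *\<^sub>R y) z w = r * K x y z w"
  "K x y (r *\<^sub>R z) w = r * K x y z w"
  "K x y z (r *\<^sub>R w) = r * K x y z w"
proof -
  show *: "K (r *\<^sub>R x) y z w = r * K x y z w" for x y z w
    using linear_scale[OF linear_K(1)] by simp
  show "K x (r *\<^sub>R y) z w = r * K x y z w"
    using *[of y x z w] K_skew12 by (metis mult_minus_right)
  show **: "K x y (r *\<^sub>R z) w = r * K x y z w" for x y z w
    using linear_scale[OF linear_K(2)] by simp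
  show "K x y z (r *\<^sub>R w) = r * K x y z w"
    using **[of x y w z] K_skew34 by (metis mult_minus_right)
qed

lemma K_minus:
  "K (- x) y z w = - K x y z w" "K x (- y) z w = - K x y z w"
  "K x y (- z) w = - K x y z w" "K x y z (- w) = - K x y z w"
  using K_scale[where r = "-1"] by simp_all

lemma K_eigenspace34:
  assumes "P a = s *\<^sub>R a" "P c = s *\<^sub>R c" "s * s = 1"
  shows "K x y a c = 0"
  using K_P_P[of x y a c] assms by (simp add: K_scale flip: mult.assoc)

lemma K_eigenspace12:
  assumes "P a = s *\<^sub>R a" "P c = s *\<^sub>R c" "s * s = 1"
  shows "K a c x y = 0"
  using K_eigenspace34[OF assms] K_pair by metis

lemma K_plus: assumes "P a = a" "P c = c" shows "K x y a c = 0" "K a c x y = 0"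
  using K_eigenspace34[of a 1 c] K_eigenspace12[of a 1 c] assms by auto

lemma K_neg: assumes "P b = - b" "P d = - d" shows "K x y b d = 0" "K b d x y = 0"
  using K_eigenspace34[of b "-1" d] K_eigenspace12[of b "-1" d] assms by auto

text \<open>For \<open>v = a + b\<close> with \<open>a\<close>, \<open>b\<close> in the two eigenspaces, \<open>g v v = 2 g a b\<close>, and only
  \<open>K a b a b\<close> survives in \<open>K v (P v) (P v) v\<close>.\<close>

lemma K_diagonal_nonisotropic:
  assumes "P a = a" "P b = - b" "g a b \<noteq> 0"
  shows "K a b a b = \<kappa> * (g a b)\<^sup>2"
proof -
  have g0: "g a a = 0" "g b b = 0"
    using isotropic_eigenspaces[of a 1 a] isotropic_eigenspaces[of b "-1" b] assms by auto
  have Pv: "P (a + b) = a + (- b)" using assms by (simp add: P_simps)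
  have "g (a + b) (a + b) \<noteq> 0" using assms g0 g_sym[of a b] by (simp add: g_simps)
  from para_holomorphic[OF this]
  have "K (a + b) (a + (- b)) (a + (- b)) (a + b) = \<kappa> * (2 * g a b * (- 2 * g a b))"
    unfolding Pv using g0 g_sym[of a b] by (simp add: g_simps power2_eq_square)
  moreover have "K (a + b) (a + (- b)) (a + (- b)) (a + b) = - 4 * K a b a b"
    using K_plus[of a a] K_neg[of b b] assms K_skew12[of b a] K_skew34[of _ _ b a]
    by (simp add: K_add K_minus del: add_uminus_conv_diff)
  ultimately show ?thesis by (simp add: power2_eq_square)
qed

text \<open>The curvature hypothesis says nothing about isotropic \<open>v\<close>. If \<open>g a b = 0\<close>, move \<open>b\<close> along a
  direction \<open>d\<close> with \<open>g a d \<noteq> 0\<close>: the difference of the two sides is quadratic in the parameter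
  and vanishes at every nonzero parameter, hence also at zero.\<close>

lemma K_diagonal:
  assumes a: "P a = a" and b: "P b = - b"
  shows "K a b a b = \<kappa> * (g a b)\<^sup>2"
proof (cases "g a b = 0 \<and> a \<noteq> 0")
  case True
  then obtain w where w: "g a w \<noteq> 0" using nondegenerate by blast
  define d where "d = (1/2) *\<^sub>R (w - P w)"
  have d: "P d = - d" by (simp add: d_def P_simps P_P algebra_simps)
  have "g a (P w) = - g a w" using g_P_P[of a w] a by simp
  then have gd: "g a d \<noteq> 0" using w by (simp add: d_def g_simps)
  have *: "K a b a b + t * (K a b a d + K a d a b) + t * t * K a d a d = \<kappa> * (t * t * (g a d)\<^sup>2)"
    if "t \<noteq> 0" for t
  proof -
    have "P (b + t *\<^sub>R d) = - (b + t *\<^sub>R d)" by (simp add: P_simps b d)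
    moreover have "g a (b + t *\<^sub>R d) = t * g a d" using True by (simp add: g_simps)
    ultimately have "K a (b + t *\<^sub>R d) a (b + t *\<^sub>R d) = \<kappa> * (t * g a d)\<^sup>2"
      using K_diagonal_nonisotropic[OF a, of "b + t *\<^sub>R d"] gd that by simp
    then show ?thesis by (simp add: K_add K_scale algebra_simps power2_eq_square)
  qed
  \<comment> \<open>a quadratic polynomial with three roots\<close>
  have "K a b a b = 0" using *[of 1] *[of "-1"] *[of 2] by (simp add: algebra_simps)
  then show ?thesis using True by simp
next
  case False
  then show ?thesis
    using K_diagonal_nonisotropic[OF a b] K_scale(1)[of 0 a] g_simps by fastforce
qed

text \<open>The Bianchi identity makes \<open>K a b c d\<close> symmetric in \<open>a\<close>, \<open>c\<close> and in \<open>b\<close>, \<open>d\<close>, since the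
  third cyclic term has its first two arguments in the same eigenspace. Polarizing the diagonal
  values in each pair then determines it.\<close>

lemma K_mixed:
  assumes "P a = a" "P b = - b" "P c = c" "P d = - d"
  shows "K a b c d = \<kappa> / 2 * (g a b * g c d + g a d * g c b)"
proof -
  have sym_ac: "K a b c d = K c b a d" if "P a = a" "P c = c" for a b c d
    using bianchi[of a b c d] K_plus(2)[OF that(2,1), of b d] K_skew12[of b c a d] by simp
  have sym_bd: "K a b c d = K a d c b" if "P a = a" "P c = c" for a b c d
    using sym_ac[OF that, of b d] K_pair[of c b a d] by simp
  have *: "K a b c b = \<kappa> * g a b * g c b" if "P b = - b" for b
  proof -
    have "K (a + c) b (a + c) b = \<kappa> * (g (a + c) b)\<^sup>2"
      by (rule K_diagonal) (simp_all add: P_simps assms that)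
    then show ?thesis
      using K_diagonal[OF assms(1) that] K_diagonal[OF assms(3) that] sym_ac[OF assms(1,3), of b b]
      by (simp add: K_add g_simps power2_eq_square algebra_simps)
  qed
  have "K a (b + d) c (b + d) = \<kappa> * g a (b + d) * g c (b + d)"
    by (rule *) (simp add: P_simps assms)
  then show ?thesis
    using *[OF assms(2)] *[OF assms(4)] sym_bd[OF assms(1,3), of b d]
    by (simp add: K_add g_simps algebra_simps)
qed

text \<open>The curvature of a space of constant para-holomorphic sectional curvature. In each summand the
  factor without \<open>y\<close> pairs two of the vectors \<open>x\<close>, \<open>z\<close>, \<open>w\<close>; this is the feature of the formula on
  which the result about harmonic maps rests.\<close>

lemma K_eq:
  "K x y z w = \<kappa> / 2 *
    (mixed x y * mixed z w + mixed x w * mixed z y - mixed x y * mixed w z - mixed x z * mixed w y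
     - mixed y x * mixed z w - mixed y w * mixed z x + mixed y x * mixed w z + mixed y z * mixed w x)"
proof -
  obtain a1 b1 where x: "x = a1 + b1" and 1: "P a1 = a1" "P b1 = - b1" by (rule eigen_decomposition)
  obtain a2 b2 where y: "y = a2 + b2" and 2: "P a2 = a2" "P b2 = - b2" by (rule eigen_decomposition)
  obtain a3 b3 where z: "z = a3 + b3" and 3: "P a3 = a3" "P b3 = - b3" by (rule eigen_decomposition)
  obtain a4 b4 where w: "w = a4 + b4" and 4: "P a4 = a4" "P b4 = - b4" by (rule eigen_decomposition)
  note m = mixed_decomposed
  have "K x y z w = K a1 b2 a3 b4 - K a1 b2 a4 b3 - K a2 b1 a3 b4 + K a2 b1 a4 b3"
    unfolding x y z w
    using K_plus[OF 1(1) 2(1)] K_neg[OF 1(2) 2(2)] K_plus[OF 3(1) 4(1)] K_neg[OF 3(2) 4(2)]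
      K_skew34[of a1 b2 b3 a4] K_skew12[of b1 a2 a3 b4] K_skew12[of b1 a2 b3 a4]
      K_skew34[of a2 b1 b3 a4]
    by (simp add: K_add)
  then show ?thesis
    unfolding x y z w m[OF 1 2] m[OF 1 3] m[OF 1 4] m[OF 2 1] m[OF 2 3] m[OF 2 4]
      m[OF 3 1] m[OF 3 2] m[OF 3 4] m[OF 4 1] m[OF 4 2] m[OF 4 3]
      K_mixed[OF 1(1) 2(2) 3(1) 4(2)] K_mixed[OF 1(1) 2(2) 4(1) 3(2)]
      K_mixed[OF 2(1) 1(2) 3(1) 4(2)] K_mixed[OF 2(1) 1(2) 4(1) 3(2)]
    by (simp add: algebra_simps)
qed

end

section \<open>The Levi-Civita connection of a para-Kaehler metric in a chart\<close>

lemma linear_axis_zero: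
  fixes L :: "real ^ 'n \<Rightarrow> 'b::real_vector"
  assumes "linear L" "\<And>i. L (axis i 1) = 0"
  shows "L v = 0"
proof -
  have "L b = 0" if "b \<in> Basis" for b
    using that assms(2) by (auto simp: Basis_vec_def)
  then show ?thesis using linear_expand_Basis[OF assms(1), of v] by simp
qed

lemma trilinear_axis_eq:
  fixes F H :: "real ^ 'n \<Rightarrow> real ^ 'n \<Rightarrow> real ^ 'n \<Rightarrow> real"
  assumes "\<And>v w. linear (\<lambda>u. F u v w)" "\<And>u w. linear (\<lambda>v. F u v w)" "\<And>u v. linear (\<lambda>w. F u v w)"
    and "\<And>v w. linear (\<lambda>u. H u v w)" "\<And>u w. linear (\<lambda>v. H u v w)" "\<And>u v. linear (\<lambda>w. H u v w)"
    and "\<And>i j k. F (axis i 1) (axis j 1) (axis k 1) = H (axis i 1) (axis j 1) (axis k 1)"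
  shows "F u v w = H u v w"
proof -
  have 1: "F (axis i 1) (axis j 1) w - H (axis i 1) (axis j 1) w = 0" for i j w
    by (rule linear_axis_zero[OF linear_compose_sub[OF assms(3,6)]]) (simp add: assms(7))
  have 2: "F (axis i 1) v w - H (axis i 1) v w = 0" for i v w
    by (rule linear_axis_zero[OF linear_compose_sub[OF assms(2,5)]]) (rule 1)
  have "F u v w - H u v w = 0"
    by (rule linear_axis_zero[OF linear_compose_sub[OF assms(1,4)]]) (rule 2)
  then show ?thesis by simp
qed

lemma bform_axis_left: "bform G (axis i 1) w = (\<Sum>j\<in>UNIV. G $ i $ j * w $ j)"
proof -
  have "bform G (axis i 1) w = (\<Sum>k\<in>UNIV. if k = i then (\<Sum>j\<in>UNIV. G $ i $ j * w $ j) else 0)"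
    unfolding bform_def by (rule sum.cong) (auto simp: axis_def)
  then show ?thesis by simp
qed

lemma bform_axis_right: "bform G v (axis j 1) = (\<Sum>i\<in>UNIV. G $ i $ j * v $ i)"
proof -
  have "bform G v (axis j 1) = (\<Sum>i\<in>UNIV. \<Sum>k\<in>UNIV. if k = j then G $ i $ j * v $ i else 0)"
    unfolding bform_def by (intro sum.cong refl) (auto simp: axis_def)
  then show ?thesis by simp
qed

lemma bform_axis: "bform G (axis i 1) (axis j 1) = G $ i $ j"
proof -
  have "bform G (axis i 1) (axis j 1) = (\<Sum>k\<in>UNIV. if k = j then G $ i $ k else 0)"
    unfolding bform_axis_left by (rule sum.cong) (auto simp: axis_def)
  then show ?thesis by simp
qed

lemma bform_simps:
  "bform G (v + v') w = bform G v w + bform G v' w" "bform G v (w + w') = bform G v w + bform G v w'"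
  "bform G (r *\<^sub>R v) w = r * bform G v w" "bform G v (r *\<^sub>R w) = r * bform G v w"
  "bform G (v - v') w = bform G v w - bform G v' w" "bform G v (w - w') = bform G v w - bform G v w'"
  "bform G (- v) w = - bform G v w" "bform G v (- w) = - bform G v w"
  "bform (G + G') v w = bform G v w + bform G' v w" "bform (r *\<^sub>R G) v w = r * bform G v w"
  unfolding bform_def
  by (simp_all add: algebra_simps sum.distrib sum_subtractf sum_negf sum_distrib_left)

lemma has_derivative_bform:
  assumes "(G has_derivative G') (at x)" "(s has_derivative s') (at x)" "(t has_derivative t') (at x)"
  shows "((\<lambda>y. bform (G y) (s y) (t y)) has_derivative
    (\<lambda>h. bform (G' h) (s x) (t x) + bform (G x) (s' h) (t x) + bform (G x) (s x) (t' h))) (at x)"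
proof -
  have n: "((\<lambda>y. f y $ i) has_derivative (\<lambda>h. f' h $ i)) (at x)"
    if "(f has_derivative f') (at x)" for f :: "'a \<Rightarrow> ('c::real_normed_vector) ^ 'b" and f' i
    by (rule bounded_linear.has_derivative[OF bounded_linear_vec_nth that])
  have "((\<lambda>y. bform (G y) (s y) (t y)) has_derivative
    (\<lambda>h. \<Sum>i\<in>UNIV. \<Sum>j\<in>UNIV. (G x $ i $ j * s x $ i) * t' h $ j +
      (G x $ i $ j * s' h $ i + G' h $ i $ j * s x $ i) * t x $ j)) (at x)"
    unfolding bform_def
    by (intro has_derivative_sum has_derivative_mult n assms)
  moreover have "(\<lambda>h. \<Sum>i\<in>UNIV. \<Sum>j\<in>UNIV. (G x $ i $ j * s x $ i) * t' h $ j +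
      (G x $ i $ j * s' h $ i + G' h $ i $ j * s x $ i) * t x $ j) =
    (\<lambda>h. bform (G' h) (s x) (t x) + bform (G x) (s' h) (t x) + bform (G x) (s x) (t' h))"
    unfolding bform_def by (simp add: algebra_simps sum.distrib)
  ultimately show ?thesis by simp
qed

lemma bounded_linear_matrix_apply: "bounded_linear (\<lambda>M. M *v (v :: real ^ 'n))"
  by (intro linear_conv_bounded_linear[THEN iffD1] linearI)
    (simp_all add: matrix_vector_mult_add_rdistrib scaleR_matrix_vector_assoc)

lemma has_derivative_matrix_apply:
  fixes v :: "real ^ 'n"
  assumes "(A has_derivative A') (at x)"
  shows "((\<lambda>y. A y *v v) has_derivative (\<lambda>h. A' h *v v)) (at x)"
  by (rule bounded_linear.has_derivative[OF bounded_linear_matrix_apply assms])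

lemma has_derivative_matrix_apply2:
  fixes s :: "'a::real_normed_vector \<Rightarrow> real ^ 'n" and A :: "'a \<Rightarrow> real ^ 'n ^ 'm"
  assumes "(A has_derivative A') (at x)" "(s has_derivative s') (at x)"
  shows "((\<lambda>y. A y *v s y) has_derivative (\<lambda>h. A' h *v s x + A x *v s' h)) (at x)"
proof -
  have b: "bounded_bilinear (\<lambda>(M :: real ^ 'n ^ 'm) v. M *v v)"
    unfolding bilinear_conv_bounded_bilinear[symmetric]
    by (auto simp: bilinear_def matrix_vector_right_distrib matrix_vector_mult_add_rdistrib
        scaleR_matrix_vector_assoc matrix_vector_mult_scaleR intro!: linearI)
  show ?thesis
    using bounded_bilinear.FDERIV[OF b assms] by (simp add: add.commute)
qed

lemma bform_symmetric_inner:
  assumes "\<And>v w. bform G v w = bform G w v"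
  shows "bform G v w = (G *v v) \<bullet> w"
proof -
  have "bform G w v = (\<Sum>i\<in>UNIV. (\<Sum>j\<in>UNIV. G $ i $ j * v $ j) * w $ i)"
    unfolding bform_def by (simp add: sum_distrib_left sum_distrib_right algebra_simps)
  then show ?thesis
    using assms[of v w] by (simp add: matrix_vector_mult_def inner_vec_def)
qed

text \<open>The vector \<open>\<nabla>\<^bsub>u\<^esub> v\<close> for the constant extensions of \<open>u\<close> and \<open>v\<close> in the chart.\<close>

definition christoffel_vec ::
  "(real ^ 'm \<Rightarrow> real ^ 'm ^ 'm) \<Rightarrow> real ^ 'm \<Rightarrow> real ^ 'm \<Rightarrow> real ^ 'm \<Rightarrow> real ^ 'm" where
  "christoffel_vec G x u v = (\<chi> k. \<Sum>i\<in>UNIV. \<Sum>j\<in>UNIV. christoffel G k i j x * u $ i * v $ j)"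

lemma christoffel_vec_axis:
  "christoffel_vec G x (axis i 1) (axis j 1) = (\<chi> k. christoffel G k i j x)"
  unfolding christoffel_vec_def
  using bform_axis[of "\<chi> i j. christoffel G _ i j x" i j] by (simp add: bform_def)

lemma linear_christoffel_vec:
  "linear (\<lambda>u. christoffel_vec G x u v)" "linear (\<lambda>v. christoffel_vec G x u v)"
  by (auto intro!: linearI
      simp: christoffel_vec_def vec_eq_iff algebra_simps sum.distrib sum_distrib_left)

text \<open>\<open>\<nabla>B = 0\<close> for the Levi-Civita connection of \<open>G\<close>, in coordinates.\<close>

definition parallel_form ::
  "(real ^ 'm) set \<Rightarrow> (real ^ 'm \<Rightarrow> real ^ 'm ^ 'm) \<Rightarrow> (real ^ 'm \<Rightarrow> real ^ 'm ^ 'm) \<Rightarrow> bool" where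
  "parallel_form S G B \<longleftrightarrow> (\<forall>x\<in>S. \<forall>l i j. pderiv_at l (\<lambda>y. B y $ i $ j) x =
     (\<Sum>k\<in>UNIV. christoffel G k l i x * B x $ k $ j + christoffel G k l j x * B x $ i $ k))"

lemma parallel_formI:
  assumes "\<And>x l i j. x \<in> S \<Longrightarrow> pderiv_at l (\<lambda>y. B y $ i $ j) x =
    bform (B x) (christoffel_vec G x (axis l 1) (axis i 1)) (axis j 1) +
    bform (B x) (axis i 1) (christoffel_vec G x (axis l 1) (axis j 1))"
  shows "parallel_form S G B"
  unfolding parallel_form_def
  by (simp add: assms bform_axis_left bform_axis_right christoffel_vec_axis sum.distrib mult.commute)

locale metric_chart =
  fixes S :: "(real ^ 'm) set" and G :: "real ^ 'm \<Rightarrow> real ^ 'm ^ 'm"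
  assumes open_S: "open S"
    and smooth_G: "smooth_on S G"
    and G_sym: "x \<in> S \<Longrightarrow> bform (G x) v w = bform (G x) w v"
    and G_nondegenerate: "x \<in> S \<Longrightarrow> (\<And>w. bform (G x) v w = 0) \<Longrightarrow> v = 0"
begin

abbreviation dG :: "real ^ 'm \<Rightarrow> real ^ 'm \<Rightarrow> real ^ 'm ^ 'm" where
  "dG x \<equiv> frechet_derivative G (at x)"

lemma G_derivative: "x \<in> S \<Longrightarrow> (G has_derivative dG x) (at x)"
  using smooth_G smooth_on_differentiable differentiable_imp_has_derivative by blast

lemma linear_dG: "x \<in> S \<Longrightarrow> linear (dG x)"
  using has_derivative_linear[OF G_derivative] .

lemma smooth_G_nth: "smooth_on S (\<lambda>x. G x $ i $ j)"
  by (intro smooth_on_nth open_S smooth_G)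

lemma frechet_G_nth: "x \<in> S \<Longrightarrow> frechet_derivative (\<lambda>y. G y $ i $ j) (at x) = (\<lambda>u. dG x u $ i $ j)"
  by (rule frechet_derivative_eqI)
    (rule bounded_linear.has_derivative[OF bounded_linear_vec_nth]
       bounded_linear.has_derivative[OF bounded_linear_vec_nth G_derivative] | assumption)+

lemma pderiv_G: "x \<in> S \<Longrightarrow> pderiv_at l (\<lambda>y. G y $ i $ j) x = dG x (axis l 1) $ i $ j"
  by (simp add: pderiv_at_def frechet_G_nth)

lemma det_G: assumes "x \<in> S" shows "det (G x) \<noteq> 0"
proof -
  have "v = 0" if "G x *v v = 0" for v
    using G_nondegenerate[OF assms, of v] bform_symmetric_inner[OF G_sym[OF assms], of v] that by simp
  then show ?thesis
    using matrix_left_invertible_ker invertible_det_nz invertible_left_inverse by blast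
qed

lemma smooth_christoffel: "smooth_on S (christoffel G k i j)"
proof -
  have "smooth_on S (\<lambda>x. pderiv_at l (\<lambda>y. G y $ i $ j) x)" for l i j
    unfolding pderiv_at_def by (rule smooth_on_frechet[OF smooth_G_nth])
  note d = this
  show ?thesis
    unfolding christoffel_def
    by (rule smooth_on_mult[OF open_S smooth_on_const], rule smooth_on_sum[OF open_S],
        rule smooth_on_mult[OF open_S smooth_on_matrix_inv[OF open_S smooth_G_nth det_G]], assumption,
        rule smooth_on_diff[OF open_S smooth_on_add[OF open_S d d] d])
qed

lemma dG_nth_commute:
  assumes "x \<in> S"
  shows "dG x u $ i $ j = dG x u $ j $ i"
proof -
  have "frechet_derivative (\<lambda>y. G y $ i $ j) (at x) = frechet_derivative (\<lambda>y. G y $ j $ i) (at x)"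
    by (rule frechet_derivative_cong_open[OF open_S assms]) (metis G_sym bform_axis)
  then show ?thesis using frechet_G_nth[OF assms] by metis
qed

lemma christoffel_commute:
  assumes x: "x \<in> S"
  shows "christoffel G k i j x = christoffel G k j i x"
proof -
  have "dG x u $ i $ j = dG x u $ j $ i" for u by (rule dG_nth_commute[OF x])
  then show ?thesis unfolding christoffel_def pderiv_G[OF x] by (simp add: add.commute)
qed

lemma christoffel_vec_commute: "x \<in> S \<Longrightarrow> christoffel_vec G x u v = christoffel_vec G x v u"
  unfolding christoffel_vec_def vec_eq_iff
  by (subst sum.swap) (simp add: christoffel_commute mult.commute mult.left_commute)

text \<open>The Koszul formula is the definition of the Christoffel symbols with the upper index lowered,
  so it needs checking on coordinate vectors only.\<close>

lemma koszul:
  assumes x: "x \<in> S"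
  shows "bform (G x) (christoffel_vec G x u v) w =
    1/2 * (bform (dG x u) v w + bform (dG x v) u w - bform (dG x w) u v)"
proof (rule trilinear_axis_eq)
  fix i j k
  let ?L = "\<chi> l. 1/2 * (dG x (axis i 1) $ j $ l + dG x (axis j 1) $ i $ l - dG x (axis l 1) $ i $ j)"
  have "christoffel_vec G x (axis i 1) (axis j 1) = matrix_inv (G x) *v ?L"
    unfolding christoffel_vec_axis christoffel_def pderiv_G[OF x] matrix_vector_mult_def
    by (simp add: vec_eq_iff sum_distrib_left algebra_simps)
  moreover have "G x ** matrix_inv (G x) = mat 1"
    by (rule matrix_mul_inv_right[OF det_G[OF x]])
  ultimately have "G x *v christoffel_vec G x (axis i 1) (axis j 1) = ?L"
    by (simp add: matrix_vector_mul_assoc)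
  then show "bform (G x) (christoffel_vec G x (axis i 1) (axis j 1)) (axis k 1) =
    1/2 * (bform (dG x (axis i 1)) (axis j 1) (axis k 1) + bform (dG x (axis j 1)) (axis i 1) (axis k 1)
      - bform (dG x (axis k 1)) (axis i 1) (axis j 1))"
    unfolding bform_symmetric_inner[OF G_sym[OF x]] bform_axis by (simp add: inner_axis)
qed (auto intro!: linearI simp: bform_simps linear_add[OF linear_dG[OF x]] linear_scale[OF linear_dG[OF x]]
     linear_add[OF linear_christoffel_vec(1)] linear_add[OF linear_christoffel_vec(2)]
     linear_scale[OF linear_christoffel_vec(1)] linear_scale[OF linear_christoffel_vec(2)]
     algebra_simps add_divide_distrib)

lemma dG_sym:
  assumes "x \<in> S"
  shows "bform (dG x u) v w = bform (dG x u) w v"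
proof -
  have "bform (dG x u) v w = (\<Sum>j\<in>UNIV. \<Sum>i\<in>UNIV. dG x u $ i $ j * v $ i * w $ j)"
    unfolding bform_def by (rule sum.swap)
  also have "\<dots> = (\<Sum>j\<in>UNIV. \<Sum>i\<in>UNIV. dG x u $ j $ i * w $ j * v $ i)"
    by (intro sum.cong refl) (subst dG_nth_commute[OF assms], simp)
  finally show ?thesis by (simp add: bform_def)
qed

lemma metric_compatible:
  assumes "x \<in> S"
  shows "bform (dG x u) v w =
    bform (G x) (christoffel_vec G x u v) w + bform (G x) v (christoffel_vec G x u w)"
  using koszul[OF assms, of u v w] koszul[OF assms, of u w v] G_sym[OF assms] dG_sym[OF assms]
  by (simp add: algebra_simps)

lemma parallel_G: "parallel_form S G G"
  by (rule parallel_formI) (simp add: pderiv_G metric_compatible[symmetric] bform_axis)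

end

locale para_kaehler_chart = metric_chart S G
  for S :: "(real ^ 'm) set" and G +
  fixes A :: "real ^ 'm \<Rightarrow> real ^ 'm ^ 'm"
  assumes smooth_A: "smooth_on S A"
    and A_A: "x \<in> S \<Longrightarrow> A x ** A x = mat 1"
    and G_A_A: "x \<in> S \<Longrightarrow> bform (G x) (A x *v v) (A x *v w) = - bform (G x) v w"
    and involutive: "s = 1 \<or> s = -1 \<Longrightarrow> smooth_on S X \<Longrightarrow> smooth_on S Y \<Longrightarrow>
       (\<And>x. x \<in> S \<Longrightarrow> A x *v X x = s *\<^sub>R X x) \<Longrightarrow> (\<And>x. x \<in> S \<Longrightarrow> A x *v Y x = s *\<^sub>R Y x) \<Longrightarrow>
       x \<in> S \<Longrightarrow> A x *v lie_bracket X Y x = s *\<^sub>R lie_bracket X Y x"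
    and closed: "x \<in> S \<Longrightarrow>
       pderiv_at i (\<lambda>y. bform (G y) (axis j 1) (A y *v axis k 1)) x
       + pderiv_at j (\<lambda>y. bform (G y) (axis k 1) (A y *v axis i 1)) x
       + pderiv_at k (\<lambda>y. bform (G y) (axis i 1) (A y *v axis j 1)) x = 0"
begin

abbreviation dA :: "real ^ 'm \<Rightarrow> real ^ 'm \<Rightarrow> real ^ 'm ^ 'm" where
  "dA x \<equiv> frechet_derivative A (at x)"

lemma A_derivative: "x \<in> S \<Longrightarrow> (A has_derivative dA x) (at x)"
  using smooth_A smooth_on_differentiable differentiable_imp_has_derivative by blast

lemma linear_dA: "x \<in> S \<Longrightarrow> linear (dA x)"
  using has_derivative_linear[OF A_derivative] .

lemma A_A_apply: "x \<in> S \<Longrightarrow> A x *v (A x *v v) = v"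
  by (simp add: matrix_vector_mul_assoc A_A)

lemma para_hermitian: assumes "x \<in> S" shows "para_hermitian_form (bform (G x)) ((*v) (A x))"
proof
  show "v = 0" if "\<And>w. bform (G x) v w = 0" for v
    using G_nondegenerate[OF assms] that by blast
qed (use assms G_sym G_A_A A_A_apply in
    \<open>auto intro!: linearI simp: bform_simps matrix_vector_right_distrib matrix_vector_mult_scaleR\<close>)

lemma dA_A:
  assumes "x \<in> S"
  shows "dA x u *v (A x *v v) + A x *v (dA x u *v v) = 0"
proof -
  have "((\<lambda>y. A y *v (A y *v v)) has_derivative (\<lambda>h. dA x h *v (A x *v v) + A x *v (dA x h *v v))) (at x)"
    by (intro has_derivative_matrix_apply2 has_derivative_matrix_apply A_derivative assms)
  from frechet_derivative_eqI[OF this]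
  have "dA x u *v (A x *v v) + A x *v (dA x u *v v)
      = frechet_derivative (\<lambda>y. A y *v (A y *v v)) (at x) u" by simp
  also have "frechet_derivative (\<lambda>y. A y *v (A y *v v)) (at x) = frechet_derivative (\<lambda>y. v) (at x)"
    by (rule frechet_derivative_cong_open[OF open_S assms]) (rule A_A_apply)
  finally show ?thesis by simp
qed

text \<open>The Nijenhuis tensor of \<open>A\<close> vanishes. For constant \<open>u\<close>, \<open>v\<close> the fields \<open>u + s A u\<close> and
  \<open>v + s A v\<close> with \<open>s = \<plusminus>1\<close> are sections of the \<open>s\<close>-eigendistribution; the two
  statements that their brackets are again sections add up to the claim.\<close>

lemma nijenhuis:
  assumes x: "x \<in> S"
  shows "dA x (A x *v u) *v v - dA x (A x *v v) *v u = A x *v (dA x u *v v - dA x v *v u)"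
proof -
  note [simp] = linear_add[OF linear_dA[OF x]] linear_scale[OF linear_dA[OF x]]
    linear_diff[OF linear_dA[OF x]] matrix_vector_right_distrib matrix_vector_mult_add_rdistrib
    matrix_vector_mult_diff_distrib matrix_vector_mult_diff_rdistrib
    matrix_vector_mult_scaleR scaleR_matrix_vector_assoc[symmetric]
  define a b where "a = dA x u *v v - dA x v *v u"
    and "b = dA x (A x *v u) *v v - dA x (A x *v v) *v u"
  have "A x *v (s *\<^sub>R (a + s *\<^sub>R b)) = s *\<^sub>R (s *\<^sub>R (a + s *\<^sub>R b))" if s: "s = 1 \<or> s = -1" for s :: real
  proof -
    have ss: "s * s = 1" using s by auto
    let ?X = "\<lambda>u y. u + s *\<^sub>R (A y *v u)"
    have d: "(?X u has_derivative (\<lambda>h. 0 + s *\<^sub>R (dA x h *v u))) (at x)" for u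
      by (intro has_derivative_add has_derivative_const has_derivative_scaleR_right
          has_derivative_matrix_apply A_derivative x)
    have "smooth_on S (?X u)" for u
      by (rule smooth_on_add[OF open_S smooth_on_const
            smooth_on_bounded_linear[OF open_S bounded_linear_scaleR_right
              smooth_on_bounded_linear[OF open_S bounded_linear_matrix_apply smooth_A]]])
    moreover have "A y *v ?X u y = s *\<^sub>R ?X u y" if "y \<in> S" for u y
      using A_A_apply[OF that] ss by (simp add: scaleR_right_distrib)
    ultimately have "A x *v lie_bracket (?X u) (?X v) x = s *\<^sub>R lie_bracket (?X u) (?X v) x"
      by (intro involutive s x)
    moreover have "lie_bracket (?X u) (?X v) x = s *\<^sub>R (a + s *\<^sub>R b)"
      unfolding lie_bracket_def frechet_derivative_eqI[OF d] a_def b_def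
      by (simp add: algebra_simps)
    ultimately show ?thesis by simp
  qed
  from this[of 1] this[of "-1"] have "A x *v a + A x *v b = a + b" "A x *v a - A x *v b = b - a"
    by (simp_all add: algebra_simps)
  then have "(A x *v a + A x *v b) + (A x *v a - A x *v b) = (a + b) + (b - a)" by simp
  then have "2 *\<^sub>R (A x *v a) = 2 *\<^sub>R b"
    by (simp add: scaleR_2 del: matrix_vector_right_distrib matrix_vector_mult_diff_distrib)
  then show ?thesis by (simp add: a_def b_def)
qed

text \<open>The vector \<open>(\<nabla>\<^bsub>u\<^esub> A) v\<close>.\<close>

definition covariant_A :: "real ^ 'm \<Rightarrow> real ^ 'm \<Rightarrow> real ^ 'm \<Rightarrow> real ^ 'm" where
  "covariant_A x u v = dA x u *v v + christoffel_vec G x u (A x *v v) - A x *v christoffel_vec G x u v"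

lemma form_derivative:
  assumes "x \<in> S"
  shows "frechet_derivative (\<lambda>y. bform (G y) v (A y *v w)) (at x) u =
    bform (dG x u) v (A x *v w) + bform (G x) v (dA x u *v w)"
proof -
  have "((\<lambda>y. bform (G y) v (A y *v w)) has_derivative
    (\<lambda>h. bform (dG x h) v (A x *v w) + bform (G x) 0 (A x *v w) + bform (G x) v (dA x h *v w))) (at x)"
    by (intro has_derivative_bform G_derivative has_derivative_const has_derivative_matrix_apply
        A_derivative assms)
  from frechet_derivative_eqI[OF this] show ?thesis by (simp add: bform_def)
qed

lemma form_derivative_covariant:
  assumes "x \<in> S"
  shows "bform (G x) v (covariant_A x u w) =
    frechet_derivative (\<lambda>y. bform (G y) v (A y *v w)) (at x) u
    - bform (G x) (christoffel_vec G x u v) (A x *v w)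
    - bform (G x) v (A x *v christoffel_vec G x u w)"
  unfolding form_derivative[OF assms] metric_compatible[OF assms] covariant_A_def
  by (simp add: bform_simps)

text \<open>The structure is parallel. The trilinear form \<open>T u v w = g (v, (\<nabla>\<^bsub>u\<^esub> A) w)\<close> is the
  covariant derivative of the fundamental form, so it is skew in \<open>v\<close>, \<open>w\<close>; as the Christoffel
  symbols are symmetric, closedness becomes the cyclic identity for \<open>T\<close>, and the vanishing of the
  Nijenhuis tensor becomes the integrability hypothesis of \<open>torsion_free_form_vanishes\<close>.\<close>

lemma covariant_A_zero:
  assumes x: "x \<in> S"
  shows "covariant_A x u w = 0"
proof (rule G_nondegenerate[OF x])
  interpret para_hermitian_form "bform (G x)" "(*v) (A x)" by (rule para_hermitian[OF x])
  define T where "T u v w = bform (G x) v (covariant_A x u w)" for u v w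
  note c_simps = linear_add[OF linear_christoffel_vec(1)] linear_add[OF linear_christoffel_vec(2)]
     linear_scale[OF linear_christoffel_vec(1)] linear_scale[OF linear_christoffel_vec(2)]
     linear_add[OF linear_dA[OF x]] linear_scale[OF linear_dA[OF x]]
  have lin: "linear (\<lambda>u. T u v w)" "linear (\<lambda>v. T u v w)" "linear (\<lambda>w. T u v w)" for u v w
    by (auto intro!: linearI simp: T_def covariant_A_def g_simps P_simps c_simps
        matrix_vector_mult_add_rdistrib matrix_vector_right_distrib matrix_vector_mult_scaleR
        scaleR_matrix_vector_assoc[symmetric] algebra_simps)
  have omega_skew: "bform (G y) v (A y *v w) = - bform (G y) w (A y *v v)" if "y \<in> S" for y v w
    using G_A_A[OF that, of v "A y *v w"] G_sym[OF that] by (simp add: A_A_apply that)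
  have skew: "T u v w = - T u w v" for u v w
  proof -
    have "frechet_derivative (\<lambda>y. bform (G y) v (A y *v w)) (at x) =
        frechet_derivative (\<lambda>y. - bform (G y) w (A y *v v)) (at x)"
      by (rule frechet_derivative_cong_open[OF open_S x omega_skew])
    also have "\<dots> = (\<lambda>u. - frechet_derivative (\<lambda>y. bform (G y) w (A y *v v)) (at x) u)"
    proof (rule frechet_derivative_eqI, rule has_derivative_minus,
        rule differentiable_imp_has_derivative, rule differentiableI)
      show "((\<lambda>y. bform (G y) w (A y *v v)) has_derivative
          (\<lambda>h. bform (dG x h) w (A x *v v) + bform (G x) 0 (A x *v v) + bform (G x) w (dA x h *v v))) (at x)"
        by (intro has_derivative_bform G_derivative has_derivative_const has_derivative_matrix_apply
            A_derivative x)
    qed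
    finally have "frechet_derivative (\<lambda>y. bform (G y) v (A y *v w)) (at x) u =
       - frechet_derivative (\<lambda>y. bform (G y) w (A y *v v)) (at x) u" by simp
    then show ?thesis
      unfolding T_def form_derivative_covariant[OF x]
      using omega_skew[OF x, of "christoffel_vec G x u v" w]
        omega_skew[OF x, of v "christoffel_vec G x u w"] by simp
  qed
  have "covariant_A x u (A x *v w) = - (A x *v covariant_A x u w)" for u w
  proof -
    have "dA x u *v (A x *v w) = - (A x *v (dA x u *v w))"
      using dA_A[OF x, of u w] by (simp add: eq_neg_iff_add_eq_0)
    then show ?thesis by (simp add: covariant_A_def P_simps P_P)
  qed
  then have T_P: "T u (A x *v v) w = T u v (A x *v w)" for u v w
    by (simp add: T_def g_P_left g_simps)
  have closed_T: "T u v w + T v w u + T w u v = 0" for u v w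
  proof -
    have "T (axis i 1) (axis j 1) (axis k 1) + T (axis j 1) (axis k 1) (axis i 1)
      + T (axis k 1) (axis i 1) (axis j 1) = 0" for i j k
      using closed[OF x, of i j k] omega_skew[OF x]
      unfolding T_def form_derivative_covariant[OF x] pderiv_at_def
      by (smt (verit) christoffel_vec_commute[OF x])
    then show ?thesis
      using trilinear_axis_eq[of "\<lambda>u v w. T u v w + T v w u + T w u v" "\<lambda>u v w. 0" u v w]
      by (simp add: linear_compose_add lin linear_zero)
  qed
  have "covariant_A x (A x *v u) v - covariant_A x (A x *v v) u =
     A x *v (covariant_A x u v - covariant_A x v u)" for u v
    using nijenhuis[OF x, of u v] christoffel_vec_commute[OF x]
    by (simp add: covariant_A_def P_simps P_P algebra_simps)
  then have "T (A x *v u) w v - T (A x *v v) w u = T v (A x *v w) u - T u (A x *v w) v" for u v w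
    unfolding T_def by (metis (no_types) g_P_left g_simps(6) minus_diff_eq)
  from torsion_free_form_vanishes[where T = T and P = "(*v) (A x)", OF skew T_P closed_T this P_P]
  show "bform (G x) (covariant_A x u w) v = 0" for v
    using G_sym[OF x] by (simp add: T_def)
qed

definition omega :: "real ^ 'm \<Rightarrow> real ^ 'm ^ 'm" where
  "omega y = (\<chi> i j. bform (G y) (axis i 1) (A y *v axis j 1))"

lemma bform_omega: "bform (omega y) v w = bform (G y) v (A y *v w)"
proof -
  have "bform (omega y) v w = (\<Sum>i\<in>UNIV. \<Sum>j\<in>UNIV. \<Sum>k\<in>UNIV. G y $ i $ k * A y $ k $ j * v $ i * w $ j)"
    unfolding omega_def bform_axis_left
    by (simp add: bform_def matrix_vector_mult_basis column_def sum_distrib_right)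
  also have "\<dots> = (\<Sum>i\<in>UNIV. \<Sum>k\<in>UNIV. \<Sum>j\<in>UNIV. G y $ i $ k * A y $ k $ j * v $ i * w $ j)"
    by (intro sum.cong refl sum.swap)
  also have "\<dots> = bform (G y) v (A y *v w)"
    by (simp add: bform_def matrix_vector_mult_def sum_distrib_left algebra_simps)
  finally show ?thesis .
qed

lemma parallel_omega: "parallel_form S G omega"
proof (rule parallel_formI)
  fix x l i j assume x: "x \<in> S"
  have g0: "bform (G x) v 0 = 0" for v by (simp add: bform_def)
  show "pderiv_at l (\<lambda>y. omega y $ i $ j) x =
    bform (omega x) (christoffel_vec G x (axis l 1) (axis i 1)) (axis j 1) +
    bform (omega x) (axis i 1) (christoffel_vec G x (axis l 1) (axis j 1))"
    using form_derivative_covariant[OF x, of "axis i 1" "axis l 1" "axis j 1"]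
    by (simp add: covariant_A_zero[OF x] pderiv_at_def bform_omega g0) (simp add: omega_def)
qed

lemma smooth_omega_nth: "smooth_on S (\<lambda>x. omega x $ i $ j)"
proof -
  have "smooth_on S (\<lambda>x. A x $ k $ j)" for k by (intro smooth_on_nth open_S smooth_A)
  then have "smooth_on S (\<lambda>x. \<Sum>k\<in>UNIV. G x $ i $ k * A x $ k $ j)"
    by (intro smooth_on_sum smooth_on_mult smooth_G_nth open_S)
  then show ?thesis
    by (simp add: omega_def bform_axis_left matrix_vector_mult_basis column_def)
qed

end

section \<open>Complex-linear extensions\<close>

definition complex_linear :: "(complex ^ 'n \<Rightarrow> complex) \<Rightarrow> bool" where
  "complex_linear L \<longleftrightarrow> (\<forall>x y. L (x + y) = L x + L y) \<and> (\<forall>c x. L (c *s x) = c * L x)"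

text \<open>Real multilinear identities pass to complex vectors through this lemma, applied one
  argument at a time: both sides only have to be compared on the real basis.\<close>

lemma complex_linear_axis_eq:
  assumes "complex_linear L" "complex_linear L'" "\<And>i. L (axis i 1) = L' (axis i 1)"
  shows "L v = L' v"
proof -
  have e: "M v = (\<Sum>i\<in>UNIV. v $ i * M (axis i 1))" if "complex_linear M" for M
  proof -
    have 0: "M 0 = 0" using that unfolding complex_linear_def by (metis add_cancel_right_left)
    have s: "M (\<Sum>i\<in>I. f i) = (\<Sum>i\<in>I. M (f i))" for I and f :: "'a \<Rightarrow> complex ^ 'a"
      by (induction I rule: infinite_finite_induct) (use that 0 in \<open>auto simp: complex_linear_def\<close>)
    have "M v = M (\<Sum>i\<in>UNIV. v $ i *s axis i 1)" by (simp only: basis_expansion)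
    then show ?thesis using that by (simp add: s complex_linear_def)
  qed
  show ?thesis unfolding e[OF assms(1)] e[OF assms(2)] by (simp add: assms(3))
qed

definition cvec :: "real ^ 'n \<Rightarrow> complex ^ 'n" where
  "cvec v = (\<chi> i. complex_of_real (v $ i))"

lemma cvec_nth [simp]: "cvec v $ i = complex_of_real (v $ i)"
  by (simp add: cvec_def)

lemma cvec_axis: "cvec (axis i 1) = axis i 1"
  by (simp add: vec_eq_iff axis_def)

text \<open>The extension is bilinear, not sesquilinear: the conjugation in \<^const>\<open>q_complex\<close> is absorbed
  by the identity between \<open>\<phi>\<^bsub>zbar,k\<^esub>\<close> and the conjugate of \<open>\<phi>\<^bsub>z,k\<^esub>\<close>, see
  \<open>iterated_derivative_zbar\<close> below.\<close>

definition cform :: "real ^ 'n ^ 'n \<Rightarrow> complex ^ 'n \<Rightarrow> complex ^ 'n \<Rightarrow> complex" where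
  "cform B V W = (\<Sum>i\<in>UNIV. \<Sum>j\<in>UNIV. complex_of_real (B $ i $ j) * V $ i * W $ j)"

lemma cform_cvec: "cform B (cvec v) (cvec w) = complex_of_real (bform B v w)"
  by (simp add: cform_def bform_def)

lemma cform_simps:
  "cform B (v + v') w = cform B v w + cform B v' w" "cform B v (w + w') = cform B v w + cform B v w'"
  "cform B (v - v') w = cform B v w - cform B v' w" "cform B v (w - w') = cform B v w - cform B v w'"
  "cform B (c *s v) w = c * cform B v w" "cform B v (c *s w) = c * cform B v w"
  "cform B 0 w = 0" "cform B v 0 = 0"
  unfolding cform_def
  by (simp_all add: algebra_simps sum.distrib sum_subtractf sum_distrib_left)

lemma cform_axis_left: "cform B (axis i 1) w = (\<Sum>j\<in>UNIV. complex_of_real (B $ i $ j) * w $ j)"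
proof -
  have "cform B (axis i 1) w =
      (\<Sum>k\<in>UNIV. if k = i then (\<Sum>j\<in>UNIV. complex_of_real (B $ i $ j) * w $ j) else 0)"
    unfolding cform_def by (rule sum.cong) (auto simp: axis_def)
  then show ?thesis by simp
qed

lemma cform_axis_right: "cform B v (axis j 1) = (\<Sum>i\<in>UNIV. complex_of_real (B $ i $ j) * v $ i)"
proof -
  have "cform B v (axis j 1) =
      (\<Sum>i\<in>UNIV. \<Sum>k\<in>UNIV. if k = j then complex_of_real (B $ i $ j) * v $ i else 0)"
    unfolding cform_def by (intro sum.cong refl) (auto simp: axis_def)
  then show ?thesis by simp
qed

lemma cform_axis: "cform B (axis i 1) (axis j 1) = complex_of_real (B $ i $ j)"
  using cform_cvec[of B "axis i 1" "axis j 1"] by (simp add: cvec_axis bform_axis)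

text \<open>The Christoffel product, its derivative along \<open>L\<close> with \<open>U\<close> and \<open>V\<close> held constant, and the
  curvature as the combination of the two that a commutator of pulled-back derivatives produces.\<close>

definition conn :: "(real ^ 'm \<Rightarrow> real ^ 'm ^ 'm) \<Rightarrow> real ^ 'm \<Rightarrow> complex ^ 'm \<Rightarrow> complex ^ 'm \<Rightarrow> complex ^ 'm" where
  "conn G x U V = (\<chi> k. cform (\<chi> i j. christoffel G k i j x) U V)"

definition dconn ::
  "(real ^ 'm \<Rightarrow> real ^ 'm ^ 'm) \<Rightarrow> real ^ 'm \<Rightarrow> complex ^ 'm \<Rightarrow> complex ^ 'm \<Rightarrow> complex ^ 'm \<Rightarrow> complex ^ 'm"
  where "dconn G x L U V =
    (\<chi> k. \<Sum>l\<in>UNIV. L $ l * cform (\<chi> i j. pderiv_at l (christoffel G k i j) x) U V)"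

definition ccurv ::
  "(real ^ 'm \<Rightarrow> real ^ 'm ^ 'm) \<Rightarrow> real ^ 'm \<Rightarrow> complex ^ 'm \<Rightarrow> complex ^ 'm \<Rightarrow> complex ^ 'm \<Rightarrow> complex ^ 'm"
  where "ccurv G x U V W = dconn G x U V W - dconn G x V U W
    + conn G x U (conn G x V W) - conn G x V (conn G x U W)"

lemma conn_simps:
  "conn G x (v + v') w = conn G x v w + conn G x v' w" "conn G x v (w + w') = conn G x v w + conn G x v w'"
  "conn G x (c *s v) w = c *s conn G x v w" "conn G x v (c *s w) = c *s conn G x v w"
  by (simp_all add: conn_def vec_eq_iff cform_simps)

lemma dconn_simps:
  "dconn G x (u + u') v w = dconn G x u v w + dconn G x u' v w"
  "dconn G x u (v + v') w = dconn G x u v w + dconn G x u v' w"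
  "dconn G x u v (w + w') = dconn G x u v w + dconn G x u v w'"
  "dconn G x (c *s u) v w = c *s dconn G x u v w"
  "dconn G x u (c *s v) w = c *s dconn G x u v w"
  "dconn G x u v (c *s w) = c *s dconn G x u v w"
  by (simp_all add: dconn_def vec_eq_iff cform_simps algebra_simps sum.distrib sum_distrib_left)

lemma ccurv_simps:
  "ccurv G x (u + u') v w = ccurv G x u v w + ccurv G x u' v w"
  "ccurv G x u (v + v') w = ccurv G x u v w + ccurv G x u v' w"
  "ccurv G x u v (w + w') = ccurv G x u v w + ccurv G x u v w'"
  "ccurv G x (c *s u) v w = c *s ccurv G x u v w"
  "ccurv G x u (c *s v) w = c *s ccurv G x u v w"
  "ccurv G x u v (c *s w) = c *s ccurv G x u v w"
  by (simp_all add: ccurv_def dconn_simps conn_simps vector_add_ldistrib vector_ssub_ldistrib)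

lemma conn_axis: "conn G x (axis i 1) (axis j 1) = (\<chi> k. complex_of_real (christoffel G k i j x))"
  by (simp add: conn_def cform_axis)

lemma conn_axis_left:
  "conn G x (axis i 1) w = (\<chi> k. \<Sum>j\<in>UNIV. complex_of_real (christoffel G k i j x) * w $ j)"
  by (simp add: conn_def cform_axis_left)

lemma sum_axis_left:
  fixes c :: "'n::finite \<Rightarrow> complex"
  shows "(\<Sum>p\<in>UNIV. axis l 1 $ p * c p) = c l"
proof -
  have "(\<Sum>p\<in>UNIV. axis l 1 $ p * c p) = (\<Sum>p\<in>UNIV. if p = l then c l else 0)"
    by (rule sum.cong) (auto simp: axis_def)
  then show ?thesis by simp
qed

lemma dconn_axis:
  "dconn G x (axis l 1) (axis i 1) (axis j 1) =
   (\<chi> k. complex_of_real (pderiv_at l (christoffel G k i j) x))"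
  by (simp add: dconn_def cform_axis sum_axis_left)

lemma curvature_axis:
  "curvature G x (axis a 1) (axis b 1) (axis c 1) =
    (\<chi> l. pderiv_at a (christoffel G l b c) x - pderiv_at b (christoffel G l a c) x
      + (\<Sum>m\<in>UNIV. christoffel G l a m x * christoffel G m b c x
                  - christoffel G l b m x * christoffel G m a c x))"
proof -
  have "(\<Sum>i\<in>UNIV. \<Sum>j\<in>UNIV. \<Sum>k\<in>UNIV. axis a 1 $ i * axis b 1 $ j * axis c 1 $ k * f i j k) = f a b c"
    for f :: "'a \<Rightarrow> 'a \<Rightarrow> 'a \<Rightarrow> real"
  proof -
    have "(\<Sum>k\<in>UNIV. axis a 1 $ i * axis b 1 $ j * axis c 1 $ k * f i j k) =
        (\<Sum>k\<in>UNIV. if k = c then axis a 1 $ i * axis b 1 $ j * f i j c else 0)" for i j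
      by (rule sum.cong) (auto simp: axis_def)
    then have "(\<Sum>i\<in>UNIV. \<Sum>j\<in>UNIV. \<Sum>k\<in>UNIV. axis a 1 $ i * axis b 1 $ j * axis c 1 $ k * f i j k) =
       bform (\<chi> i j. f i j c) (axis a 1) (axis b 1)"
      by (simp add: bform_def ac_simps)
    then show ?thesis by (simp add: bform_axis)
  qed
  then show ?thesis by (simp add: curvature_def)
qed

lemma ccurv_axis:
  "ccurv G x (axis a 1) (axis b 1) (axis c 1) = cvec (curvature G x (axis a 1) (axis b 1) (axis c 1))"
  by (simp add: ccurv_def dconn_axis conn_axis conn_axis_left curvature_axis vec_eq_iff sum_subtractf
      sum_axis_left mult.commute[of "complex_of_real _" "axis _ _ $ _"])

text \<open>Stated for an arbitrary coefficient \<open>c\<close>, so that the long coefficient of the curvature tensor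
  is never expanded.\<close>

lemma triple_sum_linear:
  fixes u v w :: "real ^ 'n" and c :: "'n \<Rightarrow> 'n \<Rightarrow> 'n \<Rightarrow> real"
  defines "T \<equiv> \<lambda>(u :: real ^ 'n) (v :: real ^ 'n) (w :: real ^ 'n).
    \<Sum>i\<in>UNIV. \<Sum>j\<in>UNIV. \<Sum>k\<in>UNIV. u $ i * v $ j * w $ k * c i j k"
  shows "T (u + u') v w = T u v w + T u' v w" "T u (v + v') w = T u v w + T u v' w"
    "T u v (w + w') = T u v w + T u v w'"
    "T (r *\<^sub>R u) v w = r * T u v w" "T u (r *\<^sub>R v) w = r * T u v w" "T u v (r *\<^sub>R w) = r * T u v w"
  unfolding T_def
  by (simp_all add: ring_distribs sum.distrib sum_distrib_left mult.assoc mult.left_commute[of r])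

lemma curvature_simps:
  "curvature G x (u + u') v w = curvature G x u v w + curvature G x u' v w"
  "curvature G x u (v + v') w = curvature G x u v w + curvature G x u v' w"
  "curvature G x u v (w + w') = curvature G x u v w + curvature G x u v w'"
  "curvature G x (r *\<^sub>R u) v w = r *\<^sub>R curvature G x u v w"
  "curvature G x u (r *\<^sub>R v) w = r *\<^sub>R curvature G x u v w"
  "curvature G x u v (r *\<^sub>R w) = r *\<^sub>R curvature G x u v w"
  by (simp_all only: curvature_def vec_eq_iff vec_lambda_beta vector_add_component[of "vec_lambda _"]
      vector_scaleR_component[of _ "vec_lambda _"] real_scaleR_def triple_sum_linear simp_thms)

lemma ccurv_cvec: "ccurv G x (cvec u) (cvec v) (cvec w) = cvec (curvature G x u v w)"
proof -
  have e: "Re (ccurv G x (cvec u) (cvec v) (cvec w) $ k) = curvature G x u v w $ k \<and>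
      Im (ccurv G x (cvec u) (cvec v) (cvec w) $ k) = 0" for k
  proof -
    have add: "cvec (a + b) = cvec a + cvec b" and scale: "cvec (r *\<^sub>R a) = complex_of_real r *s cvec a"
      for a b :: "real ^ 'a" and r by (simp_all add: vec_eq_iff)
    have "Re (ccurv G x (cvec u) (cvec v) (cvec w) $ k) = curvature G x u v w $ k"
      by (rule trilinear_axis_eq[of "\<lambda>u v w. Re (ccurv G x (cvec u) (cvec v) (cvec w) $ k)"])
        (auto intro!: linearI simp: add scale ccurv_simps curvature_simps cvec_axis ccurv_axis)
    moreover have "Im (ccurv G x (cvec u) (cvec v) (cvec w) $ k) = 0"
      by (rule trilinear_axis_eq[of "\<lambda>u v w. Im (ccurv G x (cvec u) (cvec v) (cvec w) $ k)" "\<lambda>u v w. 0"])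
        (auto intro!: linearI simp: add scale ccurv_simps cvec_axis ccurv_axis)
    ultimately show ?thesis by blast
  qed
  show ?thesis using e by (simp add: vec_eq_iff complex_eq_iff)
qed

section \<open>Constant-coefficient derivations on the surface\<close>

text \<open>Besides \<^const>\<open>d_z\<close> and \<^const>\<open>d_zbar\<close> this covers the two real partial derivatives, which
  are what the curvature identities on real tangent vectors need.\<close>

definition dir_op :: "complex \<Rightarrow> complex \<Rightarrow> (complex \<Rightarrow> complex) \<Rightarrow> complex \<Rightarrow> complex" where
  "dir_op a b F \<zeta> = a * frechet_derivative F (at \<zeta>) 1 + b * frechet_derivative F (at \<zeta>) \<i>"

lemma d_z_eq: "d_z = dir_op (1/2) (- \<i>/2)" and d_zbar_eq: "d_zbar = dir_op (1/2) (\<i>/2)"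
  by (auto simp: fun_eq_iff d_z_def d_zbar_def dir_op_def field_simps)

lemma dir_op_cong:
  assumes "open \<Omega>" "\<zeta> \<in> \<Omega>" "\<And>w. w \<in> \<Omega> \<Longrightarrow> F w = H w"
  shows "dir_op a b F \<zeta> = dir_op a b H \<zeta>"
  unfolding dir_op_def using frechet_derivative_cong_open[OF assms] by simp

lemma dir_op_const: "dir_op a b (\<lambda>w. c) \<zeta> = 0"
  by (simp add: dir_op_def)

lemma dir_op_add:
  assumes "F differentiable (at \<zeta>)" "H differentiable (at \<zeta>)"
  shows "dir_op a b (\<lambda>w. F w + H w) \<zeta> = dir_op a b F \<zeta> + dir_op a b H \<zeta>"
  unfolding dir_op_def
    frechet_derivative_eqI[OF has_derivative_add[OF assms[THEN differentiable_imp_has_derivative]]]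
  by (simp add: algebra_simps)

lemma dir_op_sum:
  assumes "\<And>i. i \<in> I \<Longrightarrow> F i differentiable (at \<zeta>)"
  shows "dir_op a b (\<lambda>w. \<Sum>i\<in>I. F i w) \<zeta> = (\<Sum>i\<in>I. dir_op a b (F i) \<zeta>)"
proof -
  have "((\<lambda>w. \<Sum>i\<in>I. F i w) has_derivative (\<lambda>h. \<Sum>i\<in>I. frechet_derivative (F i) (at \<zeta>) h)) (at \<zeta>)"
    by (intro has_derivative_sum differentiable_imp_has_derivative assms)
  from frechet_derivative_eqI[OF this] show ?thesis
    by (simp add: dir_op_def sum.distrib sum_distrib_left)
qed

lemma dir_op_mult:
  assumes "F differentiable (at \<zeta>)" "H differentiable (at \<zeta>)"
  shows "dir_op a b (\<lambda>w. F w * H w) \<zeta> = dir_op a b F \<zeta> * H \<zeta> + F \<zeta> * dir_op a b H \<zeta>"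
  unfolding dir_op_def
    frechet_derivative_eqI[OF has_derivative_mult[OF assms[THEN differentiable_imp_has_derivative]]]
  by (simp add: algebra_simps)

lemma smooth_on_dir_op:
  "open \<Omega> \<Longrightarrow> smooth_on \<Omega> F \<Longrightarrow> smooth_on \<Omega> (dir_op a b F)"
  unfolding dir_op_def[abs_def]
  by (intro smooth_on_add smooth_on_mult smooth_on_const smooth_on_frechet)

lemma dir_op_commute:
  assumes "open \<Omega>" "\<zeta> \<in> \<Omega>" "smooth_on \<Omega> F"
  shows "dir_op a b (dir_op a' b' F) \<zeta> = dir_op a' b' (dir_op a b F) \<zeta>"
proof -
  have e: "dir_op a b (dir_op a' b' F) \<zeta> =
    a * a' * frechet_derivative (\<lambda>w. frechet_derivative F (at w) 1) (at \<zeta>) 1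
    + a * b' * frechet_derivative (\<lambda>w. frechet_derivative F (at w) \<i>) (at \<zeta>) 1
    + b * a' * frechet_derivative (\<lambda>w. frechet_derivative F (at w) 1) (at \<zeta>) \<i>
    + b * b' * frechet_derivative (\<lambda>w. frechet_derivative F (at w) \<i>) (at \<zeta>) \<i>" for a b a' b'
  proof -
    have d: "(\<lambda>w. frechet_derivative F (at w) e) differentiable (at \<zeta>)" for e
      using smooth_on_differentiable[OF smooth_on_frechet[OF assms(3)] assms(2)] .
    have "(dir_op a' b' F has_derivative
       (\<lambda>h. a' * frechet_derivative (\<lambda>w. frechet_derivative F (at w) 1) (at \<zeta>) h
          + b' * frechet_derivative (\<lambda>w. frechet_derivative F (at w) \<i>) (at \<zeta>) h)) (at \<zeta>)"
      unfolding dir_op_def[abs_def]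
      by (intro has_derivative_add has_derivative_mult_right differentiable_imp_has_derivative d)
    from frechet_derivative_eqI[OF this] show ?thesis
      by (simp add: dir_op_def[of a b] algebra_simps)
  qed
  show ?thesis
    unfolding e using frechet_derivative_commute[OF assms, of 1 \<i>] by (simp add: algebra_simps)
qed

lemma dir_op_cnj:
  assumes "F differentiable (at \<zeta>)"
  shows "dir_op (cnj a) (cnj b) (\<lambda>w. cnj (F w)) \<zeta> = cnj (dir_op a b F \<zeta>)"
  unfolding dir_op_def frechet_derivative_bounded_linear[OF bounded_linear_cnj assms] by simp

lemma dir_op_chain:
  fixes f :: "complex \<Rightarrow> real ^ 'm"
  assumes "h differentiable (at (f \<zeta>))" "f differentiable (at \<zeta>)"
  shows "dir_op a b (\<lambda>w. complex_of_real (h (f w))) \<zeta> =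
    (\<Sum>l\<in>UNIV. complex_of_real (pderiv_at l h (f \<zeta>)) * velocity (dir_op a b) f \<zeta> $ l)"
proof -
  let ?f' = "frechet_derivative f (at \<zeta>)"
  have "((\<lambda>w. complex_of_real (h (f w))) has_derivative
      (\<lambda>e. complex_of_real (frechet_derivative h (at (f \<zeta>)) (?f' e)))) (at \<zeta>)"
    by (intro bounded_linear.has_derivative[OF bounded_linear_of_real]
        has_derivative_compose[of f ?f' \<zeta> UNIV h] differentiable_imp_has_derivative assms)
  note 1 = frechet_derivative_eqI[OF this]
  have "((\<lambda>w. complex_of_real (f w $ l)) has_derivative (\<lambda>e. complex_of_real (?f' e $ l))) (at \<zeta>)" for l
    by (intro bounded_linear.has_derivative[OF bounded_linear_of_real]
        bounded_linear.has_derivative[OF bounded_linear_vec_nth] differentiable_imp_has_derivative assms)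
  note 2 = frechet_derivative_eqI[OF this]
  have "frechet_derivative h (at (f \<zeta>)) v = (\<Sum>l\<in>UNIV. pderiv_at l h (f \<zeta>) * v $ l)" for v
  proof -
    have l: "linear (frechet_derivative h (at (f \<zeta>)))" by (rule linear_frechet_derivative[OF assms(1)])
    have "frechet_derivative h (at (f \<zeta>)) v
        = frechet_derivative h (at (f \<zeta>)) (\<Sum>l\<in>UNIV. v $ l *s axis l 1)"
      by (simp only: basis_expansion)
    then show ?thesis
      by (simp add: linear_sum[OF l] linear_cmul[OF l] scalar_mult_eq_scaleR pderiv_at_def mult.commute)
  qed
  then show ?thesis
    by (simp add: dir_op_def 1 2 velocity_def sum_distrib_left sum.distrib algebra_simps)
qed

section \<open>The pulled-back connection\<close>

definition cnj_vec :: "complex ^ 'n \<Rightarrow> complex ^ 'n" where "cnj_vec V = (\<chi> k. cnj (V $ k))"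

lemma (in metric_chart) conn_commute: "x \<in> S \<Longrightarrow> conn G x U V = conn G x V U"
  unfolding conn_def cform_def vec_eq_iff
  by (subst sum.swap) (simp add: christoffel_commute ac_simps)

locale pullback = metric_chart S G
  for S :: "(real ^ 'm) set" and G +
  fixes \<Omega> :: "complex set" and f :: "complex \<Rightarrow> real ^ 'm"
  assumes open_\<Omega>: "open \<Omega>" and smooth_f: "smooth_on \<Omega> f" and f_in_S: "\<zeta> \<in> \<Omega> \<Longrightarrow> f \<zeta> \<in> S"
begin

definition smooth_section :: "(complex \<Rightarrow> complex ^ 'm) \<Rightarrow> bool" where
  "smooth_section s \<longleftrightarrow> (\<forall>k. smooth_on \<Omega> (\<lambda>w. s w $ k))"

abbreviation nabla where "nabla a b \<equiv> pullback_nabla (dir_op a b) G f"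
abbreviation vel where "vel a b \<equiv> velocity (dir_op a b) f"

definition dsec :: "complex \<Rightarrow> complex \<Rightarrow> (complex \<Rightarrow> complex ^ 'm) \<Rightarrow> complex \<Rightarrow> complex ^ 'm" where
  "dsec a b s \<zeta> = (\<chi> k. dir_op a b (\<lambda>w. s w $ k) \<zeta>)"

lemma nabla_eq: "nabla a b s \<zeta> = dsec a b s \<zeta> + conn G (f \<zeta>) (vel a b \<zeta>) (s \<zeta>)"
  by (simp add: vec_eq_iff pullback_nabla_def dsec_def conn_def cform_def)

lemma vel_eq: "vel a b = dsec a b (\<lambda>w. cvec (f w))"
  by (simp add: fun_eq_iff velocity_def dsec_def)

lemma f_image: "f ` \<Omega> \<subseteq> S" using f_in_S by blast

lemma section_differentiable:
  "smooth_section s \<Longrightarrow> \<zeta> \<in> \<Omega> \<Longrightarrow> (\<lambda>w. s w $ k) differentiable (at \<zeta>)"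
  unfolding smooth_section_def using smooth_on_differentiable by blast

lemma smooth_section_cvec_f: "smooth_section (\<lambda>w. cvec (f w))"
  unfolding smooth_section_def
  by (auto intro!: smooth_on_of_real smooth_on_nth open_\<Omega> smooth_f)

lemma smooth_section_dsec: "smooth_section s \<Longrightarrow> smooth_section (dsec a b s)"
  unfolding smooth_section_def dsec_def using smooth_on_dir_op[OF open_\<Omega>] by simp

lemma smooth_section_vel: "smooth_section (vel a b)"
  unfolding vel_eq by (intro smooth_section_dsec smooth_section_cvec_f)

lemma smooth_section_add: "smooth_section s \<Longrightarrow> smooth_section t \<Longrightarrow> smooth_section (\<lambda>w. s w + t w)"
  unfolding smooth_section_def by (simp add: smooth_on_add[OF open_\<Omega>])

lemma smooth_pulled_back: "smooth_on S h \<Longrightarrow> smooth_on \<Omega> (\<lambda>w. complex_of_real (h (f w)))"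
  by (rule smooth_on_of_real[OF open_\<Omega> smooth_on_compose[OF open_\<Omega> f_image _ smooth_f]])

lemma smooth_cform:
  assumes "\<And>i j. smooth_on S (\<lambda>x. B x $ i $ j)" "smooth_section s" "smooth_section t"
  shows "smooth_on \<Omega> (\<lambda>w. cform (B (f w)) (s w) (t w))"
  unfolding cform_def
  by (rule smooth_on_sum[OF open_\<Omega>], rule smooth_on_sum[OF open_\<Omega>],
      rule smooth_on_mult[OF open_\<Omega>], rule smooth_on_mult[OF open_\<Omega>])
    (use assms smooth_pulled_back[OF assms(1)] in \<open>auto simp: smooth_section_def\<close>)

lemma smooth_section_conn:
  assumes "smooth_section s" "smooth_section t"
  shows "smooth_section (\<lambda>w. conn G (f w) (s w) (t w))"
  unfolding smooth_section_def conn_def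
  using smooth_cform[OF _ assms, of "\<lambda>x. \<chi> i j. christoffel G _ i j x"] smooth_christoffel by simp

lemma nabla_fun: "nabla a b s = (\<lambda>w. dsec a b s w + conn G (f w) (vel a b w) (s w))"
  by (rule ext) (rule nabla_eq)

lemma smooth_section_nabla: "smooth_section s \<Longrightarrow> smooth_section (nabla a b s)"
  unfolding nabla_fun
  by (intro smooth_section_add smooth_section_dsec smooth_section_conn smooth_section_vel)

lemma dsec_cong:
  "\<zeta> \<in> \<Omega> \<Longrightarrow> (\<And>w. w \<in> \<Omega> \<Longrightarrow> s w = t w) \<Longrightarrow> dsec a b s \<zeta> = dsec a b t \<zeta>"
  unfolding dsec_def by (simp add: vec_eq_iff) (auto intro!: dir_op_cong[OF open_\<Omega>])

lemma nabla_cong: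
  "\<zeta> \<in> \<Omega> \<Longrightarrow> (\<And>w. w \<in> \<Omega> \<Longrightarrow> s w = t w) \<Longrightarrow> nabla a b s \<zeta> = nabla a b t \<zeta>"
  unfolding nabla_eq using dsec_cong[of \<zeta> s t] by simp

lemma dsec_add:
  assumes "smooth_section s" "smooth_section t" "\<zeta> \<in> \<Omega>"
  shows "dsec a b (\<lambda>w. s w + t w) \<zeta> = dsec a b s \<zeta> + dsec a b t \<zeta>"
  by (simp add: dsec_def vec_eq_iff dir_op_add section_differentiable assms)

lemma dsec_commute:
  assumes "smooth_section s" "\<zeta> \<in> \<Omega>"
  shows "dsec a b (dsec a' b' s) \<zeta> = dsec a' b' (dsec a b s) \<zeta>"
proof -
  have "(\<lambda>w. dir_op a b (\<lambda>w. s w $ k) w) = dir_op a b (\<lambda>w. s w $ k)" for a b k by simp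
  then show ?thesis
    using dir_op_commute[OF open_\<Omega> assms(2)] assms(1)
    unfolding dsec_def smooth_section_def by (simp add: vec_eq_iff)
qed

lemma dir_op_cform:
  assumes B: "\<And>i j. smooth_on S (\<lambda>x. B x $ i $ j)" and s: "smooth_section s" and t: "smooth_section t"
    and z: "\<zeta> \<in> \<Omega>"
  shows "dir_op a b (\<lambda>w. cform (B (f w)) (s w) (t w)) \<zeta> =
    (\<Sum>l\<in>UNIV. vel a b \<zeta> $ l * cform (\<chi> i j. pderiv_at l (\<lambda>x. B x $ i $ j) (f \<zeta>)) (s \<zeta>) (t \<zeta>))
    + cform (B (f \<zeta>)) (dsec a b s \<zeta>) (t \<zeta>) + cform (B (f \<zeta>)) (s \<zeta>) (dsec a b t \<zeta>)"
proof -
  have d: "(\<lambda>w. complex_of_real (B (f w) $ i $ j)) differentiable (at \<zeta>)" for i j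
    using smooth_pulled_back[OF B] smooth_on_differentiable z by blast
  have ds: "(\<lambda>w. s w $ i) differentiable (at \<zeta>)" and dt: "(\<lambda>w. t w $ i) differentiable (at \<zeta>)" for i
    using section_differentiable s t z by auto
  have c: "dir_op a b (\<lambda>w. complex_of_real (B (f w) $ i $ j)) \<zeta> =
      (\<Sum>l\<in>UNIV. complex_of_real (pderiv_at l (\<lambda>x. B x $ i $ j) (f \<zeta>)) * vel a b \<zeta> $ l)" for i j
    by (rule dir_op_chain[where h = "\<lambda>x. B x $ i $ j"])
      (use smooth_on_differentiable[OF B] smooth_on_differentiable[OF smooth_f] f_in_S z in auto)
  have "dir_op a b (\<lambda>w. cform (B (f w)) (s w) (t w)) \<zeta> =
    (\<Sum>i\<in>UNIV. \<Sum>j\<in>UNIV. dir_op a b (\<lambda>w. complex_of_real (B (f w) $ i $ j)) \<zeta> * s \<zeta> $ i * t \<zeta> $ j)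
    + cform (B (f \<zeta>)) (dsec a b s \<zeta>) (t \<zeta>) + cform (B (f \<zeta>)) (s \<zeta>) (dsec a b t \<zeta>)"
    unfolding cform_def
    by (simp add: dir_op_sum dir_op_mult d ds dt differentiable_mult differentiable_sum dsec_def
        sum.distrib algebra_simps)
  also have "(\<Sum>i\<in>UNIV. \<Sum>j\<in>UNIV. dir_op a b (\<lambda>w. complex_of_real (B (f w) $ i $ j)) \<zeta> * s \<zeta> $ i * t \<zeta> $ j)
    = (\<Sum>i\<in>UNIV. \<Sum>j\<in>UNIV. \<Sum>l\<in>UNIV. vel a b \<zeta> $ l
        * (complex_of_real (pderiv_at l (\<lambda>x. B x $ i $ j) (f \<zeta>)) * s \<zeta> $ i * t \<zeta> $ j))"
    unfolding c by (simp add: sum_distrib_right sum_distrib_left algebra_simps)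
  also have "\<dots> = (\<Sum>i\<in>UNIV. \<Sum>l\<in>UNIV. \<Sum>j\<in>UNIV. vel a b \<zeta> $ l
        * (complex_of_real (pderiv_at l (\<lambda>x. B x $ i $ j) (f \<zeta>)) * s \<zeta> $ i * t \<zeta> $ j))"
    by (intro sum.cong refl sum.swap)
  also have "\<dots> = (\<Sum>l\<in>UNIV. \<Sum>i\<in>UNIV. \<Sum>j\<in>UNIV. vel a b \<zeta> $ l
        * (complex_of_real (pderiv_at l (\<lambda>x. B x $ i $ j) (f \<zeta>)) * s \<zeta> $ i * t \<zeta> $ j))"
    by (rule sum.swap)
  finally show ?thesis by (simp add: cform_def sum_distrib_left)
qed

text \<open>Parallelism is a statement about coordinate vectors; multilinearity carries it to complex
  arguments.\<close>

lemma parallel_contraction: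
  assumes "parallel_form S G B" "x \<in> S"
  shows "(\<Sum>l\<in>UNIV. L $ l * cform (\<chi> i j. pderiv_at l (\<lambda>x. B x $ i $ j) x) V W) =
    cform (B x) (conn G x L V) W + cform (B x) V (conn G x L W)" (is "?F L V W = ?H L V W")
proof -
  have 0: "?F (axis l 1) (axis i 1) (axis j 1) = ?H (axis l 1) (axis i 1) (axis j 1)" for l i j
  proof -
    have "?F (axis l 1) (axis i 1) (axis j 1) = complex_of_real (pderiv_at l (\<lambda>x. B x $ i $ j) x)"
      by (simp add: cform_axis sum_axis_left)
    then show ?thesis
      using assms by (simp add: parallel_form_def conn_axis cform_axis_left cform_axis_right
          sum.distrib mult.commute)
  qed
  have lin: "complex_linear (\<lambda>L. ?F L V W)" "complex_linear (\<lambda>V. ?F L V W)"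
    "complex_linear (\<lambda>W. ?F L V W)" "complex_linear (\<lambda>L. ?H L V W)"
    "complex_linear (\<lambda>V. ?H L V W)" "complex_linear (\<lambda>W. ?H L V W)" for L V W
    by (auto simp: complex_linear_def cform_simps conn_simps algebra_simps sum.distrib sum_distrib_left)
  have 1: "?F (axis l 1) (axis i 1) W = ?H (axis l 1) (axis i 1) W" for l i W
    by (rule complex_linear_axis_eq[OF lin(3,6)]) (rule 0)
  have 2: "?F (axis l 1) V W = ?H (axis l 1) V W" for l V W
    by (rule complex_linear_axis_eq[OF lin(2,5)]) (rule 1)
  show ?thesis
    by (rule complex_linear_axis_eq[OF lin(1,4)]) (rule 2)
qed

lemma leibniz:
  assumes "\<And>i j. smooth_on S (\<lambda>x. B x $ i $ j)" "parallel_form S G B"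
    and "smooth_section s" "smooth_section t" "\<zeta> \<in> \<Omega>"
  shows "dir_op a b (\<lambda>w. cform (B (f w)) (s w) (t w)) \<zeta> =
    cform (B (f \<zeta>)) (nabla a b s \<zeta>) (t \<zeta>) + cform (B (f \<zeta>)) (s \<zeta>) (nabla a b t \<zeta>)"
  unfolding dir_op_cform[OF assms(1,3,4,5)] parallel_contraction[OF assms(2) f_in_S[OF assms(5)]] nabla_eq
  by (simp add: cform_simps)

lemma dsec_conn:
  assumes "smooth_section s" "smooth_section t" "\<zeta> \<in> \<Omega>"
  shows "dsec a b (\<lambda>w. conn G (f w) (s w) (t w)) \<zeta> =
    dconn G (f \<zeta>) (vel a b \<zeta>) (s \<zeta>) (t \<zeta>) + conn G (f \<zeta>) (dsec a b s \<zeta>) (t \<zeta>)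
    + conn G (f \<zeta>) (s \<zeta>) (dsec a b t \<zeta>)"
proof -
  have "dsec a b (\<lambda>w. conn G (f w) (s w) (t w)) \<zeta> =
      (\<chi> k. dir_op a b (\<lambda>w. cform (\<chi> i j. christoffel G k i j (f w)) (s w) (t w)) \<zeta>)"
    by (simp add: dsec_def conn_def)
  then show ?thesis
    using dir_op_cform[OF _ assms, of "\<lambda>x. \<chi> i j. christoffel G _ i j x"] smooth_christoffel
    by (simp add: vec_eq_iff conn_def dconn_def)
qed

lemma nabla_nabla:
  assumes "smooth_section s" "\<zeta> \<in> \<Omega>"
  shows "nabla a b (nabla a' b' s) \<zeta> =
    dsec a b (dsec a' b' s) \<zeta> + dconn G (f \<zeta>) (vel a b \<zeta>) (vel a' b' \<zeta>) (s \<zeta>)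
    + conn G (f \<zeta>) (dsec a b (vel a' b') \<zeta>) (s \<zeta>)
    + conn G (f \<zeta>) (vel a' b' \<zeta>) (dsec a b s \<zeta>) + conn G (f \<zeta>) (vel a b \<zeta>) (dsec a' b' s \<zeta>)
    + conn G (f \<zeta>) (vel a b \<zeta>) (conn G (f \<zeta>) (vel a' b' \<zeta>) (s \<zeta>))"
  unfolding nabla_fun
  by (simp add: dsec_add dsec_conn smooth_section_dsec smooth_section_conn smooth_section_vel assms
      conn_simps)

text \<open>Second coordinate derivatives of the section and of the map commute, which cancels all terms
  that are not tensorial in \<open>s\<close>.\<close>

lemma commutator:
  assumes "smooth_section s" "\<zeta> \<in> \<Omega>"
  shows "nabla a b (nabla a' b' s) \<zeta> =
    nabla a' b' (nabla a b s) \<zeta> + ccurv G (f \<zeta>) (vel a b \<zeta>) (vel a' b' \<zeta>) (s \<zeta>)"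
  unfolding nabla_nabla[OF assms] ccurv_def
  using dsec_commute[OF assms, of a b a' b']
    dsec_commute[OF smooth_section_cvec_f assms(2), of a b a' b', folded vel_eq]
  by (simp add: algebra_simps)

text \<open>Differentiating a parallel form twice along the map and antisymmetrising leaves only the
  curvature terms, because the plain second derivatives commute.\<close>

lemma parallel_curvature:
  assumes B: "\<And>i j. smooth_on S (\<lambda>x. B x $ i $ j)" "parallel_form S G B"
    and s: "smooth_section s" and t: "smooth_section t" and z: "\<zeta> \<in> \<Omega>"
  shows "cform (B (f \<zeta>)) (ccurv G (f \<zeta>) (vel a b \<zeta>) (vel a' b' \<zeta>) (s \<zeta>)) (t \<zeta>)
    + cform (B (f \<zeta>)) (s \<zeta>) (ccurv G (f \<zeta>) (vel a b \<zeta>) (vel a' b' \<zeta>) (t \<zeta>)) = 0"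
proof -
  let ?F = "\<lambda>w. cform (B (f w)) (s w) (t w)"
  have e: "dir_op a b (dir_op a' b' ?F) \<zeta> =
    cform (B (f \<zeta>)) (nabla a b (nabla a' b' s) \<zeta>) (t \<zeta>) + cform (B (f \<zeta>)) (nabla a' b' s \<zeta>) (nabla a b t \<zeta>)
    + (cform (B (f \<zeta>)) (nabla a b s \<zeta>) (nabla a' b' t \<zeta>)
       + cform (B (f \<zeta>)) (s \<zeta>) (nabla a b (nabla a' b' t) \<zeta>))" for a b a' b'
  proof -
    note ns = smooth_section_nabla[OF s] and nt = smooth_section_nabla[OF t]
    have "dir_op a b (dir_op a' b' ?F) \<zeta> =
      dir_op a b (\<lambda>w. cform (B (f w)) (nabla a' b' s w) (t w)
         + cform (B (f w)) (s w) (nabla a' b' t w)) \<zeta>"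
      by (rule dir_op_cong[OF open_\<Omega> z]) (rule leibniz[OF B s t])
    also have "\<dots> = dir_op a b (\<lambda>w. cform (B (f w)) (nabla a' b' s w) (t w)) \<zeta>
         + dir_op a b (\<lambda>w. cform (B (f w)) (s w) (nabla a' b' t w)) \<zeta>"
      by (intro dir_op_add smooth_on_differentiable[OF smooth_cform z] B(1) s t ns nt)
    finally show ?thesis unfolding leibniz[OF B ns t z] leibniz[OF B s nt z] .
  qed
  have "smooth_on \<Omega> ?F" by (rule smooth_cform[OF B(1) s t])
  from dir_op_commute[OF open_\<Omega> z this, of a b a' b']
  show ?thesis
    unfolding e commutator[OF s z, of a b] commutator[OF t z, of a b] by (simp add: cform_simps)
qed

lemma vel_cnj: "\<zeta> \<in> \<Omega> \<Longrightarrow> vel (cnj a) (cnj b) \<zeta> = cnj_vec (vel a b \<zeta>)"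
  unfolding vel_eq dsec_def cnj_vec_def
  using dir_op_cnj[OF section_differentiable[OF smooth_section_cvec_f]] by (simp add: vec_eq_iff)

lemma nabla_cnj:
  assumes "smooth_section s" "\<zeta> \<in> \<Omega>"
  shows "nabla (cnj a) (cnj b) (\<lambda>w. cnj_vec (s w)) \<zeta> = cnj_vec (nabla a b s \<zeta>)"
  unfolding nabla_eq vel_cnj[OF assms(2)]
  using dir_op_cnj[OF section_differentiable[OF assms]]
  by (simp add: vec_eq_iff cnj_vec_def dsec_def conn_def cform_def)

end

section \<open>Symmetries of the curvature\<close>

context metric_chart
begin

lemma dconn_commute: assumes "x \<in> S" shows "dconn G x L U V = dconn G x L V U"
proof -
  have "pderiv_at l (christoffel G k i j) x = pderiv_at l (christoffel G k j i) x" for l k i j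
    unfolding pderiv_at_def
    by (subst frechet_derivative_cong_open[OF open_S assms christoffel_commute]) simp_all
  then have "cform (\<chi> i j. pderiv_at l (christoffel G k i j) x) U V =
      cform (\<chi> i j. pderiv_at l (christoffel G k i j) x) V U" for l k
    unfolding cform_def by (subst sum.swap) (simp add: ac_simps)
  then show ?thesis by (simp add: dconn_def)
qed

lemma curvature_bianchi:
  assumes "x \<in> S"
  shows "curvature G x u v w + curvature G x v w u + curvature G x w u v = 0"
proof -
  have "cvec (curvature G x u v w) + cvec (curvature G x v w u) + cvec (curvature G x w u v) = 0"
    unfolding ccurv_cvec[symmetric] ccurv_def
    using dconn_commute[OF assms] conn_commute[OF assms]
    by (simp add: dconn_commute[OF assms, of "cvec u" "cvec w" "cvec v"]
      dconn_commute[OF assms, of "cvec v" "cvec w" "cvec u"]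
      dconn_commute[OF assms, of "cvec w" "cvec v" "cvec u"]
      conn_commute[OF assms, of "cvec w" "cvec v"] conn_commute[OF assms, of "cvec w" "cvec u"]
      conn_commute[OF assms, of "cvec v" "cvec u"])
  then have "complex_of_real ((curvature G x u v w + curvature G x v w u + curvature G x w u v) $ k) = 0" for k
    by (simp add: vec_eq_iff)
  then show ?thesis by (simp only: of_real_eq_0_iff) (simp add: vec_eq_iff)
qed

lemma curvature_skew12: "curvature G x u v w = - curvature G x v u w"
proof -
  have "cvec (curvature G x u v w) = - cvec (curvature G x v u w)"
    unfolding ccurv_cvec[symmetric] ccurv_def by simp
  then have "complex_of_real (curvature G x u v w $ k) = complex_of_real (- curvature G x v u w $ k)" for k
    by (simp add: vec_eq_iff)
  then show ?thesis by (simp only: vec_eq_iff of_real_eq_iff vector_uminus_component) simp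
qed

text \<open>Apply \<open>parallel_curvature\<close> to the affine map \<open>\<zeta> \<mapsto> x + Re \<zeta> u + Im \<zeta> v\<close>, whose two
  partial derivatives are \<open>u\<close> and \<open>v\<close>, and to constant sections. For the metric this is skewness of
  the curvature operator; for the fundamental form it says that the operator commutes with the
  para-complex structure.\<close>

lemma curvature_parallel:
  assumes x: "x \<in> S" and B: "\<And>i j. smooth_on S (\<lambda>x. B x $ i $ j)" "parallel_form S G B"
  shows "bform (B x) (curvature G x u v w) t + bform (B x) w (curvature G x u v t) = 0"
proof -
  define f where "f \<zeta> = x + (Re \<zeta> *\<^sub>R u + Im \<zeta> *\<^sub>R v)" for \<zeta>
  define \<Omega> where "\<Omega> = f -` S"
  have bl: "bounded_linear (\<lambda>\<zeta>. Re \<zeta> *\<^sub>R u + Im \<zeta> *\<^sub>R v)"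
    by (intro bounded_linear_add bounded_linear_scaleR_const bounded_linear_Re bounded_linear_Im)
  have "continuous_on UNIV f"
    unfolding f_def by (intro continuous_intros)
  then have "open \<Omega>" unfolding \<Omega>_def using open_S by (simp add: continuous_on_open_vimage)
  moreover have "smooth_on \<Omega> f"
    unfolding f_def
    by (rule smooth_on_add[OF \<open>open \<Omega>\<close> smooth_on_const
          smooth_on_bounded_linear[OF \<open>open \<Omega>\<close> bl smooth_on_id]])
  ultimately interpret pullback S G \<Omega> f by unfold_locales (auto simp: \<Omega>_def)
  have f0: "f 0 = x" by (simp add: f_def)
  have 0: "0 \<in> \<Omega>" using x by (simp add: \<Omega>_def f0)
  have "((\<lambda>w. complex_of_real (f w $ k)) has_derivative
      (\<lambda>h. complex_of_real ((0 + (Re h *\<^sub>R u + Im h *\<^sub>R v)) $ k))) (at 0)" for k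
    unfolding f_def
    by (intro bounded_linear.has_derivative[OF bounded_linear_of_real]
        bounded_linear.has_derivative[OF bounded_linear_vec_nth] has_derivative_add
        has_derivative_const has_derivative_scaleR_left bounded_linear.has_derivative[OF bounded_linear_Re]
        bounded_linear.has_derivative[OF bounded_linear_Im] has_derivative_ident)
  note d = frechet_derivative_eqI[OF this]
  have vel: "vel 1 0 0 = cvec u" "vel 0 1 0 = cvec v"
    by (simp_all add: velocity_def dir_op_def d vec_eq_iff)
  have sec: "smooth_section (\<lambda>_. cvec w)" for w
    by (simp add: smooth_section_def smooth_on_const)
  have "complex_of_real (bform (B x) (curvature G x u v w) t + bform (B x) w (curvature G x u v t)) = 0"
    using parallel_curvature[OF B sec sec 0, of 1 0 0 1 w t]
    by (simp add: vel f0 ccurv_cvec cform_cvec)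
  then show ?thesis by (simp only: of_real_eq_0_iff)
qed

end

locale constant_curvature_chart = para_kaehler_chart S G A
  for S :: "(real ^ 'm) set" and G A +
  fixes \<kappa> :: real
  assumes constant_curvature:
    "x \<in> S \<Longrightarrow> bform (G x) v v \<noteq> 0 \<Longrightarrow> sectional_curvature G x v (A x *v v) = \<kappa>"
begin

lemma curvature_form:
  assumes x: "x \<in> S"
  shows "para_kaehler_curvature_form (bform (G x)) ((*v) (A x))
     (\<lambda>u v w t. bform (G x) (curvature G x u v w) t) \<kappa>"
proof -
  interpret para_hermitian_form "bform (G x)" "(*v) (A x)" by (rule para_hermitian[OF x])
  let ?K = "\<lambda>u v w t. bform (G x) (curvature G x u v w) t"
  have 34: "?K u v w t = - ?K u v t w" for u v w t
    using curvature_parallel[OF x smooth_G_nth parallel_G, of u v w t] g_sym[of w] by simp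
  have P: "?K u v (A x *v w) (A x *v t) = - ?K u v w t" for u v w t
  proof -
    have "?K u v (A x *v w) (A x *v t) = - bform (G x) (A x *v w) (A x *v curvature G x u v t)"
      using curvature_parallel[OF x smooth_omega_nth parallel_omega, of u v "A x *v w" t]
      by (simp add: bform_omega)
    then show ?thesis using 34[of u v w t] g_sym by (simp add: g_P_P)
  qed
  show ?thesis
  proof unfold_locales
    fix v assume v: "bform (G x) v v \<noteq> 0"
    have "bform (G x) v (A x *v v) = 0" using g_P_left[of v v] g_sym[of "A x *v v" v] by simp
    then have "bform (G x) v v * bform (G x) (A x *v v) (A x *v v) - (bform (G x) v (A x *v v))\<^sup>2 \<noteq> 0"
      using v by (simp add: g_P_P)
    then show "?K v (A x *v v) (A x *v v) v =
        \<kappa> * (bform (G x) v v * bform (G x) (A x *v v) (A x *v v) - (bform (G x) v (A x *v v))\<^sup>2)"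
      using constant_curvature[OF x v] by (simp add: sectional_curvature_def field_simps)
  next
    show "?K u v w t + ?K v w u t + ?K w u v t = 0" for u v w t
      using curvature_bianchi[OF x, of u v w] g_simps(1,9) by metis
    show "?K u v w t = - ?K v u w t" for u v w t
      using curvature_skew12[of x u v w] by (simp add: g_simps)
    show "?K u v w t = - ?K u v t w" for u v w t by (rule 34)
    show "?K u v (A x *v w) (A x *v t) = - ?K u v w t" for u v w t by (rule P)
  qed (auto intro!: linearI simp: curvature_simps g_simps)
qed

definition cmixed :: "real ^ 'm \<Rightarrow> complex ^ 'm \<Rightarrow> complex ^ 'm \<Rightarrow> complex" where
  "cmixed x U V = (cform (G x) U V - cform (omega x) U V) / 2"

text \<open>The right-hand side of \<open>K_eq\<close> for \<open>\<sigma> = 1\<close>. Replacing the last argument by its image under the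
  para-complex structure turns pairing by the metric into pairing by the fundamental form; by
  \<open>mixed_P_right\<close> and \<open>mixed_P_left\<close> this changes the sign of exactly the terms in which \<open>w\<close> is a
  second argument of \<open>e\<close>, which is the case \<open>\<sigma> = -1\<close>.\<close>

definition model_curvature ::
  "(complex ^ 'm \<Rightarrow> complex ^ 'm \<Rightarrow> complex) \<Rightarrow> real \<Rightarrow>
   complex ^ 'm \<Rightarrow> complex ^ 'm \<Rightarrow> complex ^ 'm \<Rightarrow> complex ^ 'm \<Rightarrow> complex" where
  "model_curvature e \<sigma> x y z w = complex_of_real (\<kappa> / 2) *
    (complex_of_real \<sigma> * (e x y * e z w + e x w * e z y - e y x * e z w - e y w * e z x)
     - e x y * e w z - e x z * e w y + e y x * e w z + e y z * e w x)"

lemma cmixed_simps: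
  "cmixed x (u + u') v = cmixed x u v + cmixed x u' v" "cmixed x u (v + v') = cmixed x u v + cmixed x u v'"
  "cmixed x (c *s u) v = c * cmixed x u v" "cmixed x u (c *s v) = c * cmixed x u v"
  by (simp_all add: cmixed_def cform_simps algebra_simps add_divide_distrib diff_divide_distrib)

lemma ccurv_model:
  assumes x: "x \<in> S"
    and B: "B = G \<and> \<sigma> = 1 \<or> B = omega \<and> \<sigma> = -1"
  shows "cform (B x) (ccurv G x U V W) T = model_curvature (cmixed x) \<sigma> U V W T"
proof -
  interpret para_kaehler_curvature_form "bform (G x)" "(*v) (A x)"
     "\<lambda>u v w t. bform (G x) (curvature G x u v w) t" \<kappa>
    by (rule curvature_form[OF x])
  let ?F = "\<lambda>U V W T. cform (B x) (ccurv G x U V W) T"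
  let ?H = "model_curvature (cmixed x) \<sigma>"
  have m: "cmixed x (axis i 1) (axis j 1) = complex_of_real (mixed (axis i 1) (axis j 1))" for i j
    using bform_omega[of x "axis i 1" "axis j 1"]
    by (simp add: cmixed_def mixed_def cform_axis bform_axis)
  have 0: "?F (axis i 1) (axis j 1) (axis k 1) (axis l 1) = ?H (axis i 1) (axis j 1) (axis k 1) (axis l 1)"
    for i j k l
  proof -
    have "?F (axis i 1) (axis j 1) (axis k 1) (axis l 1) = complex_of_real
        (bform (B x) (curvature G x (axis i 1) (axis j 1) (axis k 1)) (axis l 1))"
      using cform_cvec[of "B x" "curvature G x (axis i 1) (axis j 1) (axis k 1)" "axis l 1"]
      by (simp add: ccurv_axis cvec_axis)
    moreover have "bform (B x) (curvature G x u v w) t = \<kappa> / 2 *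
      (\<sigma> * (mixed u v * mixed w t + mixed u t * mixed w v - mixed v u * mixed w t - mixed v t * mixed w u)
       - mixed u v * mixed t w - mixed u w * mixed t v + mixed v u * mixed t w + mixed v w * mixed t u)"
      for u v w t
      using B
    proof
      assume "B = G \<and> \<sigma> = 1"
      then show ?thesis by (simp add: K_eq algebra_simps)
    next
      assume "B = omega \<and> \<sigma> = -1"
      then show ?thesis
        using K_eq[of u v w "A x *v t"] by (simp add: bform_omega mixed_P_right mixed_P_left)
    qed
    ultimately show ?thesis by (simp add: model_curvature_def m)
  qed
  have lin: "complex_linear (\<lambda>U. ?F U V W T)" "complex_linear (\<lambda>V. ?F U V W T)"
    "complex_linear (\<lambda>W. ?F U V W T)" "complex_linear (\<lambda>T. ?F U V W T)" for U V W T
    by (simp_all add: complex_linear_def ccurv_simps cform_simps)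
  have lin': "complex_linear (\<lambda>U. ?H U V W T)" "complex_linear (\<lambda>V. ?H U V W T)"
    "complex_linear (\<lambda>W. ?H U V W T)" "complex_linear (\<lambda>T. ?H U V W T)" for U V W T
    by (simp_all add: complex_linear_def model_curvature_def cmixed_simps algebra_simps
        add_divide_distrib diff_divide_distrib)
  have 1: "?F (axis i 1) (axis j 1) (axis k 1) T = ?H (axis i 1) (axis j 1) (axis k 1) T" for i j k T
    by (rule complex_linear_axis_eq[OF lin(4) lin'(4)]) (rule 0)
  have 2: "?F (axis i 1) (axis j 1) W T = ?H (axis i 1) (axis j 1) W T" for i j W T
    by (rule complex_linear_axis_eq[OF lin(3) lin'(3)]) (rule 1)
  have 3: "?F (axis i 1) V W T = ?H (axis i 1) V W T" for i V W T
    by (rule complex_linear_axis_eq[OF lin(2) lin'(2)]) (rule 2)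
  show ?thesis
    by (rule complex_linear_axis_eq[OF lin(1) lin'(1)]) (rule 3)
qed

text \<open>In every summand of the model curvature the factor without \<open>V\<close> pairs two of the vectors
  \<open>U\<close>, \<open>W\<close>, \<open>T\<close>.\<close>

lemma ccurv_isotropic:
  assumes "x \<in> S" "B = G \<or> B = omega"
    and "\<And>B. B = G \<or> B = omega \<Longrightarrow> cform (B x) U W = 0 \<and> cform (B x) W U = 0 \<and>
      cform (B x) U T = 0 \<and> cform (B x) T U = 0 \<and> cform (B x) W T = 0 \<and> cform (B x) T W = 0"
  shows "cform (B x) (ccurv G x U V W) T = 0"
proof -
  have "cmixed x U W = 0" "cmixed x W U = 0" "cmixed x U T = 0" "cmixed x T U = 0"
    "cmixed x W T = 0" "cmixed x T W = 0"
    using assms(3)[of G] assms(3)[of omega] by (auto simp: cmixed_def)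
  then have "model_curvature (cmixed x) \<sigma> U V W T = 0" for \<sigma>
    by (simp add: model_curvature_def)
  then show ?thesis using ccurv_model[OF assms(1), of B] assms(2) by metis
qed

end

section \<open>Harmonic maps\<close>

locale harmonic_chart = constant_curvature_chart S G A \<kappa> + pullback S G \<Omega> f
  for S :: "(real ^ 'm) set" and G A \<kappa> \<Omega> f +
  assumes harmonic: "\<zeta> \<in> \<Omega> \<Longrightarrow> pullback_nabla d_zbar G f (velocity d_z f) \<zeta> = 0"
begin

abbreviation "Dz \<equiv> pullback_nabla d_z G f"
abbreviation "Dzbar \<equiv> pullback_nabla d_zbar G f"
text \<open>\<open>jet k\<close> is \<open>\<phi>\<^bsub>z,k\<^esub>\<close>, so the index starts at \<open>1\<close>.\<close>

abbreviation jet :: "nat \<Rightarrow> complex \<Rightarrow> complex ^ 'm" where "jet \<equiv> iterated_derivative d_z G f"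

definition pairing :: "(real ^ 'm \<Rightarrow> real ^ 'm ^ 'm) \<Rightarrow> nat \<Rightarrow> nat \<Rightarrow> complex \<Rightarrow> complex" where
  "pairing B \<alpha> \<beta> \<zeta> = cform (B (f \<zeta>)) (jet \<alpha> \<zeta>) (jet \<beta> \<zeta>)"

lemma jet_Suc: "k \<ge> 1 \<Longrightarrow> jet (Suc k) = Dz (jet k)"
  by (cases k) (simp_all add: iterated_derivative_def)

lemma jet_1: "jet 1 = velocity d_z f"
  by (simp add: iterated_derivative_def)

lemma smooth_section_Dz: "smooth_section s \<Longrightarrow> smooth_section (Dz s)"
  and smooth_section_Dzbar: "smooth_section s \<Longrightarrow> smooth_section (Dzbar s)"
  unfolding d_z_eq d_zbar_eq by (erule smooth_section_nabla)+

lemma commutator_z: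
  assumes "smooth_section s" "\<zeta> \<in> \<Omega>"
  shows "Dz (Dzbar s) \<zeta> =
    Dzbar (Dz s) \<zeta> + ccurv G (f \<zeta>) (velocity d_z f \<zeta>) (velocity d_zbar f \<zeta>) (s \<zeta>)"
  unfolding d_z_eq d_zbar_eq by (rule commutator[OF assms])

lemma smooth_section_jet: "smooth_section (jet k)"
proof -
  have "smooth_section ((Dz ^^ n) (velocity d_z f))" for n
    by (induction n) (simp_all add: smooth_section_Dz smooth_section_vel[of "1/2" "-\<i>/2", folded d_z_eq])
  then show ?thesis by (simp add: iterated_derivative_def)
qed

text \<open>The map is real, so conjugation exchanges the two kinds of derivatives.\<close>

lemma iterated_derivative_zbar:
  "\<zeta> \<in> \<Omega> \<Longrightarrow> iterated_derivative d_zbar G f k \<zeta> = cnj_vec (jet k \<zeta>)"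
proof -
  have c: "cnj (1/2) = 1/2" "cnj (-\<i>/2) = \<i>/2" by simp_all
  have "\<zeta> \<in> \<Omega> \<Longrightarrow> (Dzbar ^^ n) (velocity d_zbar f) \<zeta> = cnj_vec ((Dz ^^ n) (velocity d_z f) \<zeta>)" for n \<zeta>
  proof (induction n arbitrary: \<zeta>)
    case 0
    then show ?case using vel_cnj[OF 0, where a = "1/2" and b = "-\<i>/2"] unfolding c d_z_eq d_zbar_eq by simp
  next
    case (Suc n)
    let ?s = "(Dz ^^ n) (velocity d_z f)"
    have "smooth_section ?s" using smooth_section_jet[of "Suc n"] by (simp add: iterated_derivative_def)
    from nabla_cnj[OF this Suc.prems, where a = "1/2" and b = "-\<i>/2"]
    have "Dzbar (\<lambda>w. cnj_vec (?s w)) \<zeta> = cnj_vec (Dz ?s \<zeta>)"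
      unfolding c d_z_eq[symmetric] d_zbar_eq[symmetric] .
    moreover have "Dzbar ((Dzbar ^^ n) (velocity d_zbar f)) \<zeta> = Dzbar (\<lambda>w. cnj_vec (?s w)) \<zeta>"
      using nabla_cong[OF Suc.prems Suc.IH, where a = "1/2" and b = "\<i>/2"] unfolding d_zbar_eq[symmetric] .
    ultimately show ?case by simp
  qed
  then show "\<zeta> \<in> \<Omega> \<Longrightarrow> ?thesis" by (simp add: iterated_derivative_def)
qed

lemma d_z_vanishing:
  assumes "\<And>w. w \<in> \<Omega> \<Longrightarrow> F w = 0" "\<zeta> \<in> \<Omega>"
  shows "d_z F \<zeta> = 0"
  using dir_op_cong[OF open_\<Omega> assms(2), of F "\<lambda>_. 0"] assms(1) unfolding d_z_eq by (simp add: dir_op_const)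

context
  fixes B assumes B: "B = G \<or> B = omega"
begin

lemma smooth_B: "smooth_on S (\<lambda>x. B x $ i $ j)"
  using B smooth_G_nth smooth_omega_nth by auto

lemma parallel_B: "parallel_form S G B"
  using B parallel_G parallel_omega by auto

lemma leibniz_z:
  assumes "smooth_section s" "smooth_section t" "\<zeta> \<in> \<Omega>"
  shows "d_z (\<lambda>w. cform (B (f w)) (s w) (t w)) \<zeta> =
      cform (B (f \<zeta>)) (Dz s \<zeta>) (t \<zeta>) + cform (B (f \<zeta>)) (s \<zeta>) (Dz t \<zeta>)"
    and "d_zbar (\<lambda>w. cform (B (f w)) (s w) (t w)) \<zeta> =
      cform (B (f \<zeta>)) (Dzbar s \<zeta>) (t \<zeta>) + cform (B (f \<zeta>)) (s \<zeta>) (Dzbar t \<zeta>)"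
  unfolding d_z_eq d_zbar_eq by (rule leibniz[OF smooth_B parallel_B assms])+

lemma pairing_differentiable: "\<zeta> \<in> \<Omega> \<Longrightarrow> pairing B \<alpha> \<beta> differentiable (at \<zeta>)"
  unfolding pairing_def
  by (rule smooth_on_differentiable[OF smooth_cform[OF smooth_B smooth_section_jet smooth_section_jet]])

end

context
  fixes \<gamma> :: nat
  assumes isotropic: "\<And>B \<alpha> \<beta> \<zeta>. B = G \<or> B = omega \<Longrightarrow> \<alpha> \<ge> 1 \<Longrightarrow> \<beta> \<ge> 1 \<Longrightarrow> \<alpha> + \<beta> \<le> \<gamma> \<Longrightarrow>
    \<zeta> \<in> \<Omega> \<Longrightarrow> pairing B \<alpha> \<beta> \<zeta> = 0"
begin

text \<open>Differentiate \<open>\<eta>\<^bsub>\<alpha>,\<beta>\<^esub> = 0\<close> for \<open>\<alpha> + \<beta> = \<gamma>\<close> by \<open>\<partial>\<^sub>z\<close>: neighbouring values on the next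
  antidiagonal are opposite.\<close>

lemma pairing_antidiagonal:
  assumes B: "B = G \<or> B = omega" and "\<beta> \<ge> 1" "\<alpha> \<ge> 1" "\<alpha> + \<beta> = \<gamma> + 1" "\<zeta> \<in> \<Omega>"
  shows "pairing B \<alpha> \<beta> \<zeta> = (-1) ^ (\<beta> - 1) * pairing B \<gamma> 1 \<zeta>"
  using assms(2-4)
proof (induction \<beta> arbitrary: \<alpha> rule: nat_induct_at_least)
  case base
  then show ?case by simp
next
  case (Suc \<beta>)
  have "d_z (pairing B \<alpha> \<beta>) \<zeta> = 0"
    by (rule d_z_vanishing[OF isotropic[OF B] assms(5)]) (use Suc in auto)
  then have "pairing B (Suc \<alpha>) \<beta> \<zeta> + pairing B \<alpha> (Suc \<beta>) \<zeta> = 0"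
    unfolding pairing_def jet_Suc[OF Suc.prems(1)] jet_Suc[OF Suc.hyps]
    by (simp add: leibniz_z(1)[OF B smooth_section_jet smooth_section_jet assms(5)])
  moreover have "pairing B (Suc \<alpha>) \<beta> \<zeta> = (-1) ^ (\<beta> - 1) * pairing B \<gamma> 1 \<zeta>"
    by (rule Suc.IH) (use Suc.prems in auto)
  moreover have "(-1 :: complex) ^ (Suc \<beta> - 1) = - ((-1) ^ (\<beta> - 1))"
    using Suc.hyps by (cases \<beta>) auto
  ultimately show ?case by (simp add: add_eq_0_iff2 add.commute[of "pairing B (Suc \<alpha>) \<beta> \<zeta>"])
qed

text \<open>Induction on \<open>k\<close>. Commuting the derivatives in \<open>\<nabla>\<^bsub>zbar\<^esub> \<nabla>\<^bsub>z\<^esub> \<phi>\<^bsub>z,k\<^esub>\<close> costs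
  \<open>R(\<phi>\<^bsub>z,1\<^esub>, \<phi>\<^bsub>zbar,1\<^esub>) \<phi>\<^bsub>z,k\<^esub>\<close>, which pairs to zero with \<open>\<phi>\<^bsub>z,\<beta>\<^esub>\<close> by
  \<open>ccurv_isotropic\<close>; the commuted term is dealt with by moving \<open>\<nabla>\<^bsub>z\<^esub>\<close> to the other factor, which
  raises \<open>\<beta>\<close> by one. This is why the induction needs all \<open>\<beta>\<close> and not only \<open>\<beta> = 1\<close>.\<close>

lemma Dzbar_jet_orthogonal:
  assumes B: "B = G \<or> B = omega" and "k \<ge> 1" "\<beta> \<ge> 1" "k + \<beta> \<le> \<gamma> + 1" "\<zeta> \<in> \<Omega>"
  shows "cform (B (f \<zeta>)) (Dzbar (jet k) \<zeta>) (jet \<beta> \<zeta>) = 0"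
  using assms(2-5)
proof (induction k arbitrary: \<beta> \<zeta> rule: nat_induct_at_least)
  case base
  then show ?case using harmonic by (simp add: jet_1[simplified] cform_simps)
next
  case (Suc k)
  let ?R = "ccurv G (f \<zeta>) (velocity d_z f \<zeta>) (velocity d_zbar f \<zeta>) (jet k \<zeta>)"
  note jets = smooth_section_jet[of k] smooth_section_jet[of \<beta>]
  have "d_z (\<lambda>w. cform (B (f w)) (Dzbar (jet k) w) (jet \<beta> w)) \<zeta> = 0"
    by (rule d_z_vanishing[OF Suc.IH Suc.prems(3)]) (use Suc.prems in auto)
  then have "cform (B (f \<zeta>)) (Dz (Dzbar (jet k)) \<zeta>) (jet \<beta> \<zeta>)
      + cform (B (f \<zeta>)) (Dzbar (jet k) \<zeta>) (jet (Suc \<beta>) \<zeta>) = 0"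
    unfolding jet_Suc[OF Suc.prems(1)]
    by (simp add: leibniz_z(1)[OF B smooth_section_Dzbar[OF jets(1)] jets(2) Suc.prems(3)])
  moreover have "cform (B (f \<zeta>)) (Dzbar (jet k) \<zeta>) (jet (Suc \<beta>) \<zeta>) = 0"
    by (rule Suc.IH) (use Suc.prems in auto)
  moreover have "Dz (Dzbar (jet k)) \<zeta> = Dzbar (jet (Suc k)) \<zeta> + ?R"
    unfolding jet_Suc[OF Suc.hyps] by (rule commutator_z[OF jets(1) Suc.prems(3)])
  moreover have "cform (B (f \<zeta>)) ?R (jet \<beta> \<zeta>) = 0"
  proof (rule ccurv_isotropic[OF f_in_S[OF Suc.prems(3)] B])
    fix B' assume B': "B' = G \<or> B' = omega"
    show "cform (B' (f \<zeta>)) (velocity d_z f \<zeta>) (jet k \<zeta>) = 0 \<and>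
      cform (B' (f \<zeta>)) (jet k \<zeta>) (velocity d_z f \<zeta>) = 0 \<and>
      cform (B' (f \<zeta>)) (velocity d_z f \<zeta>) (jet \<beta> \<zeta>) = 0 \<and>
      cform (B' (f \<zeta>)) (jet \<beta> \<zeta>) (velocity d_z f \<zeta>) = 0 \<and>
      cform (B' (f \<zeta>)) (jet k \<zeta>) (jet \<beta> \<zeta>) = 0 \<and> cform (B' (f \<zeta>)) (jet \<beta> \<zeta>) (jet k \<zeta>) = 0"
      unfolding jet_1[symmetric] pairing_def[symmetric]
      by (intro conjI isotropic[OF B']) (use Suc in auto)
  qed
  ultimately show ?case by (simp add: cform_simps)
qed

lemma d_zbar_pairing:
  assumes B: "B = G \<or> B = omega" and "\<gamma> \<ge> 1" "\<zeta> \<in> \<Omega>"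
  shows "d_zbar (pairing B \<gamma> 1) \<zeta> = 0"
proof -
  have "d_zbar (pairing B \<gamma> 1) \<zeta> = cform (B (f \<zeta>)) (Dzbar (jet \<gamma>) \<zeta>) (jet 1 \<zeta>)
      + cform (B (f \<zeta>)) (jet \<gamma> \<zeta>) (Dzbar (jet 1) \<zeta>)"
    unfolding pairing_def by (rule leibniz_z(2)[OF B smooth_section_jet smooth_section_jet assms(3)])
  then show ?thesis
    using Dzbar_jet_orthogonal[OF B assms(2) _ _ assms(3), of 1] harmonic[OF assms(3)]
    unfolding jet_1 by (simp add: cform_simps)
qed

end

lemma q_complex_jets:
  assumes "\<zeta> \<in> \<Omega>"
  shows "q_complex (G (f \<zeta>)) (A (f \<zeta>)) (jet \<alpha> \<zeta>) (iterated_derivative d_zbar G f \<beta> \<zeta>) =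
    (pairing G \<alpha> \<beta> \<zeta>, pairing omega \<alpha> \<beta> \<zeta>)"
  unfolding iterated_derivative_zbar[OF assms]
  by (simp add: q_complex_def q_frame_def prod_eq_iff fst_sum snd_sum pairing_def cform_def cnj_vec_def
      bform_axis omega_def)

end

section \<open>Reduction to charts\<close>

text \<open>The greatest element in the definition of the isotropic order always exists: it is \<open>\<infinity>\<close>, or one
  less than the first \<open>n\<close> such that some \<open>\<eta>\<^bsub>\<alpha>,\<beta>\<^esub>\<close> with \<open>\<alpha> + \<beta> = n\<close> does not vanish. So a
  finite isotropic order does have the vanishing property.\<close>

lemma isotropic_order_vanishing:
  assumes "isotropic_order \<X> \<A> P g \<phi> = enat \<gamma>"
  shows "\<gamma> \<ge> 1 \<and> (\<forall>\<alpha> \<beta>. \<alpha> \<ge> 1 \<and> \<beta> \<ge> 1 \<and> \<alpha> + \<beta> \<le> \<gamma> \<longrightarrow>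
    (\<forall>z\<in>\<X>. \<forall>c\<in>\<A>. \<forall>\<zeta>\<in>local_dom \<phi> z c. eta P g \<phi> z c \<alpha> \<beta> \<zeta> = 0))"
proof -
  define V where "V n \<longleftrightarrow> (\<forall>\<alpha> \<beta>. \<alpha> \<ge> 1 \<and> \<beta> \<ge> 1 \<and> \<alpha> + \<beta> = n \<longrightarrow>
    (\<forall>z\<in>\<X>. \<forall>c\<in>\<A>. \<forall>\<zeta>\<in>local_dom \<phi> z c. eta P g \<phi> z c \<alpha> \<beta> \<zeta> = 0))" for n
  define Q where "Q e \<longleftrightarrow> e \<ge> 1 \<and> (\<forall>n. enat n \<le> e \<longrightarrow> V n)" for e
  have Q_eq: "(\<lambda>e. e \<ge> 1 \<and> (\<forall>\<alpha> \<beta>. \<alpha> \<ge> 1 \<and> \<beta> \<ge> 1 \<and> enat (\<alpha> + \<beta>) \<le> e \<longrightarrow>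
           (\<forall>z\<in>\<X>. \<forall>c\<in>\<A>. \<forall>\<zeta>\<in>local_dom \<phi> z c. eta P g \<phi> z c \<alpha> \<beta> \<zeta> = 0))) = Q"
    unfolding Q_def V_def by (intro ext) blast
  have "\<exists>e. Q e \<and> (\<forall>e'. Q e' \<longrightarrow> e' \<le> e)"
  proof (cases "\<forall>n. V n")
    case True
    then have "Q \<infinity>" by (simp add: Q_def)
    then show ?thesis by auto
  next
    case False
    define m where "m = (LEAST n. \<not> V n)"
    have m: "\<not> V m" "\<And>n. n < m \<Longrightarrow> V n"
      using False LeastI_ex[of "\<lambda>n. \<not> V n"] not_less_Least unfolding m_def by blast+
    have "m \<ge> 2" using m(1) unfolding V_def by auto
    have "Q (enat (m - 1))"
      unfolding Q_def using \<open>m \<ge> 2\<close> m(2) by (auto simp: one_enat_def)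
    moreover have "e' \<le> enat (m - 1)" if "Q e'" for e'
    proof -
      have "\<not> enat m \<le> e'" using that m(1) unfolding Q_def by blast
      then have "e' < enat m" by simp
      then show ?thesis using \<open>m \<ge> 2\<close> by (cases e') auto
    qed
    ultimately show ?thesis by blast
  qed
  then obtain e where e: "Q e" "\<And>e'. Q e' \<Longrightarrow> e' \<le> e" by blast
  have "isotropic_order \<X> \<A> P g \<phi> = Greatest Q"
    unfolding isotropic_order_def Q_eq ..
  also have "\<dots> = e" by (rule Greatest_equality[of Q e, OF e])
  finally have "Q (enat \<gamma>)" using e(1) assms by simp
  then show ?thesis unfolding Q_def V_def by (auto simp: one_enat_def)
qed

lemma open_local_dom:
  assumes "is_chart z" "is_chart c" "continuous_on UNIV \<phi>"
  shows "open (local_dom \<phi> z c)"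
proof -
  have h: "homeomorphism (fst z) (chart_img z) (snd z) (chart_inv z)" and o: "open (fst z)" "open (chart_img z)"
    using assms(1) unfolding is_chart_def by auto
  have "open (\<phi> -` fst c)"
    using assms(2,3) unfolding is_chart_def by (simp add: continuous_on_open_vimage)
  then have "openin (top_of_set (fst z)) (fst z \<inter> \<phi> -` fst c)"
    using o(1) by (auto simp: openin_open_eq)
  from homeomorphism_imp_open_map[OF h this] show ?thesis
    unfolding local_dom_def using o(2) openin_open_trans by blast
qed

lemma local_rep_in_chart:
  assumes "is_chart z" "\<zeta> \<in> local_dom \<phi> z c"
  shows "local_rep \<phi> z c \<zeta> \<in> chart_img c"
proof -
  have h: "homeomorphism (fst z) (chart_img z) (snd z) (chart_inv z)"
    using assms(1) unfolding is_chart_def by auto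
  obtain p where p: "p \<in> fst z" "\<phi> p \<in> fst c" "\<zeta> = snd z p"
    using assms(2) unfolding local_dom_def by auto
  then have "chart_inv z \<zeta> = p" using homeomorphism_apply1[OF h] by simp
  then show ?thesis using p by (simp add: local_rep_def)
qed

lemma para_kaehler_chartI:
  assumes pk: "para_kaehler \<A> P g" and c: "c \<in> \<A>"
  shows "para_kaehler_chart (chart_img c) (g c) (P c)"
proof
  have "is_chart c"
    using pk c unfolding para_kaehler_def smooth_manifold_def maximal_atlas_def by blast
  then show "open (chart_img c)" unfolding is_chart_def by blast
  show "smooth_on (chart_img c) (g c)"
    using pk c unfolding para_kaehler_def pseudo_riemannian_def bilinear_tensor_def by blast
  show "smooth_on (chart_img c) (P c)"
    using pk c unfolding para_kaehler_def endomorphism_tensor_def by blast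
  show "bform (g c x) v w = bform (g c x) w v" if "x \<in> chart_img c" for x v w
    using pk c that unfolding para_kaehler_def pseudo_riemannian_def by blast
  show "v = 0" if "x \<in> chart_img c" "\<And>w. bform (g c x) v w = 0" for x v
    using pk c that unfolding para_kaehler_def pseudo_riemannian_def by blast
  show "P c x ** P c x = mat 1" if "x \<in> chart_img c" for x
    using pk c that unfolding para_kaehler_def by blast
  show "bform (g c x) (P c x *v v) (P c x *v w) = - bform (g c x) v w" if "x \<in> chart_img c" for x v w
    using pk c that unfolding para_kaehler_def by blast
  show "P c x *v lie_bracket X Y x = s *\<^sub>R lie_bracket X Y x"
    if "s = 1 \<or> s = -1" "smooth_on (chart_img c) X" "smooth_on (chart_img c) Y"
      "\<And>x. x \<in> chart_img c \<Longrightarrow> P c x *v X x = s *\<^sub>R X x"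
      "\<And>x. x \<in> chart_img c \<Longrightarrow> P c x *v Y x = s *\<^sub>R Y x" "x \<in> chart_img c" for s X Y x
  proof -
    have "involutive_eigendistribution \<A> P s" using pk that(1) unfolding para_kaehler_def by auto
    then show ?thesis
      using c that(2-) \<open>open (chart_img c)\<close> unfolding involutive_eigendistribution_def by blast
  qed
  show "pderiv_at i (\<lambda>y. bform (g c y) (axis j 1) (P c y *v axis k 1)) x
       + pderiv_at j (\<lambda>y. bform (g c y) (axis k 1) (P c y *v axis i 1)) x
       + pderiv_at k (\<lambda>y. bform (g c y) (axis i 1) (P c y *v axis j 1)) x = 0"
    if "x \<in> chart_img c" for x i j k
  proof -
    have "closed_two_form \<A> (fundamental_form P g)" using pk unfolding para_kaehler_def by blast
    from this[unfolded closed_two_form_def, rule_format, OF c that, of i j k]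
    show ?thesis by (simp add: fundamental_form_def)
  qed
qed

theorem theoremA2:
  fixes \<X> :: "('x::t2_space, complex) chart set"
    and \<A> :: "('p::{t2_space, second_countable_topology}, real ^ 'm) chart set"
    and P g :: "('p, 'm) tensor2"
    and \<phi> :: "'x \<Rightarrow> 'p"
    and n \<gamma> :: nat
  assumes "riemann_surface \<X>"
    and "para_kaehler \<A> P g"
    and "CARD('m) = 2 * n"
    and "constant_para_holomorphic_curvature \<A> P g"
    and "harmonic_map \<X> \<A> g \<phi>"
    and "isotropic_order \<X> \<A> P g \<phi> = enat \<gamma>"
  shows "(\<forall>\<alpha> \<beta>. \<alpha> \<ge> 1 \<and> \<beta> \<ge> 1 \<and> \<alpha> + \<beta> = \<gamma> + 1 \<longrightarrow>
            (\<forall>z\<in>\<X>. \<forall>c\<in>\<A>. \<forall>\<zeta>\<in>local_dom \<phi> z c.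
               eta P g \<phi> z c \<alpha> \<beta> \<zeta> = (-1) ^ (\<beta> - 1) *\<^sub>R eta P g \<phi> z c \<gamma> 1 \<zeta>))
       \<and> (\<forall>z\<in>\<X>. \<forall>c\<in>\<A>. holomorphic_coefficient (local_dom \<phi> z c) (eta P g \<phi> z c \<gamma> 1))"
proof -
  note iso = isotropic_order_vanishing[OF assms(6)]
  have smooth: "smooth_map \<X> \<A> \<phi>" using assms(5) unfolding harmonic_map_def by blast
  obtain \<kappa> where \<kappa>: "\<forall>c\<in>\<A>. \<forall>x\<in>chart_img c. \<forall>v. bform (g c x) v v \<noteq> 0 \<longrightarrow>
      sectional_curvature (g c) x v (P c x *v v) = \<kappa>"
    using assms(4) unfolding constant_para_holomorphic_curvature_def by (rule exE)
  have "(\<forall>\<alpha> \<beta>. \<alpha> \<ge> 1 \<and> \<beta> \<ge> 1 \<and> \<alpha> + \<beta> = \<gamma> + 1 \<longrightarrow> (\<forall>\<zeta>\<in>local_dom \<phi> z c.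
      eta P g \<phi> z c \<alpha> \<beta> \<zeta> = (-1) ^ (\<beta> - 1) *\<^sub>R eta P g \<phi> z c \<gamma> 1 \<zeta>)) \<and>
    holomorphic_coefficient (local_dom \<phi> z c) (eta P g \<phi> z c \<gamma> 1)"
    if z: "z \<in> \<X>" and c: "c \<in> \<A>" for z c
  proof -
    let ?\<Omega> = "local_dom \<phi> z c" and ?f = "local_rep \<phi> z c"
    have charts: "is_chart z" "is_chart c"
      using assms(1,2) z c
      unfolding riemann_surface_def para_kaehler_def smooth_manifold_def maximal_atlas_def by blast+
    interpret para_kaehler_chart "chart_img c" "g c" "P c"
      by (rule para_kaehler_chartI[OF assms(2) c])
    interpret harmonic_chart "chart_img c" "g c" "P c" \<kappa> ?\<Omega> ?f
    proof unfold_locales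
      show "open ?\<Omega>" using open_local_dom charts smooth unfolding smooth_map_def by blast
      show "smooth_on ?\<Omega> ?f" using smooth z c unfolding smooth_map_def by blast
      show "?f \<zeta> \<in> chart_img c" if "\<zeta> \<in> ?\<Omega>" for \<zeta> by (rule local_rep_in_chart[OF charts(1) that])
      show "pullback_nabla d_zbar (g c) ?f (velocity d_z ?f) \<zeta> = 0" if "\<zeta> \<in> ?\<Omega>" for \<zeta>
        using assms(5) z c that unfolding harmonic_map_def by (simp add: iterated_derivative_def)
    qed (rule \<kappa>[rule_format, OF c])
    have eta: "eta P g \<phi> z c \<alpha> \<beta> \<zeta> = (pairing (g c) \<alpha> \<beta> \<zeta>, pairing omega \<alpha> \<beta> \<zeta>)"
      if "\<zeta> \<in> ?\<Omega>" for \<alpha> \<beta> \<zeta>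
      using q_complex_jets[OF that] by (simp add: eta_def Let_def)
    have isotropic: "pairing B \<alpha> \<beta> \<zeta> = 0"
      if "B = g c \<or> B = omega" "\<alpha> \<ge> 1" "\<beta> \<ge> 1" "\<alpha> + \<beta> \<le> \<gamma>" "\<zeta> \<in> ?\<Omega>" for B \<alpha> \<beta> \<zeta>
      using iso that z c eta[OF that(5), of \<alpha> \<beta>] by (auto simp: zero_prod_def)
    have "eta P g \<phi> z c \<alpha> \<beta> \<zeta> = (-1) ^ (\<beta> - 1) *\<^sub>R eta P g \<phi> z c \<gamma> 1 \<zeta>"
      if "\<alpha> \<ge> 1" "\<beta> \<ge> 1" "\<alpha> + \<beta> = \<gamma> + 1" "\<zeta> \<in> ?\<Omega>" for \<alpha> \<beta> \<zeta>
      using pairing_antidiagonal[OF isotropic _ that(2,1,3,4)]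
      by (simp add: eta[OF that(4)] scaleR_conv_of_real)
    moreover have "holomorphic_coefficient ?\<Omega> (eta P g \<phi> z c \<gamma> 1)"
      unfolding holomorphic_coefficient_def
    proof (intro ballI conjI)
      fix \<zeta> assume \<zeta>: "\<zeta> \<in> ?\<Omega>"
      have "(\<lambda>w. (pairing (g c) \<gamma> 1 w, pairing omega \<gamma> 1 w)) differentiable (at \<zeta>)"
        using pairing_differentiable[OF _ \<zeta>] unfolding differentiable_def
        by (blast intro: has_derivative_Pair)
      from differentiable_cong_open[OF open_\<Omega> \<zeta> _ this, of "eta P g \<phi> z c \<gamma> 1"]
      show "eta P g \<phi> z c \<gamma> 1 differentiable (at \<zeta>)" by (simp add: eta)
      have "d_zbar (\<lambda>w. fst (eta P g \<phi> z c \<gamma> 1 w)) \<zeta> = d_zbar (pairing (g c) \<gamma> 1) \<zeta>"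
        unfolding d_zbar_eq by (rule dir_op_cong[OF open_\<Omega> \<zeta>]) (simp add: eta)
      then show "d_zbar (\<lambda>w. fst (eta P g \<phi> z c \<gamma> 1 w)) \<zeta> = 0"
        using d_zbar_pairing[OF isotropic _ _ \<zeta>] iso by simp
      have "d_zbar (\<lambda>w. snd (eta P g \<phi> z c \<gamma> 1 w)) \<zeta> = d_zbar (pairing omega \<gamma> 1) \<zeta>"
        unfolding d_zbar_eq by (rule dir_op_cong[OF open_\<Omega> \<zeta>]) (simp add: eta)
      then show "d_zbar (\<lambda>w. snd (eta P g \<phi> z c \<gamma> 1 w)) \<zeta> = 0"
        using d_zbar_pairing[OF isotropic _ _ \<zeta>] iso by simp
    qed
    ultimately show ?thesis by blast
  qed
  then show ?thesis by blast
qed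

end
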